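(* Let $G$ be a $2$-connected graph which is $K_{1,3}$-free and $K_4$-minor-free. Then $G$ is outerplanar. Furthermore, $G$ is isomorphic to $\mathcal{Z}_d$ or $\mathcal{Z}^*_d$ for some $d\ge1$, or to a graph in $\mathcal{S}_t$ for some $t\ge3$.
   Context: All graphs are finite, simple and undirected. $G$ is $H$-free if it has no induced subgraph isomorphic to $H$; $H$-minor-free if it has no minor isomorphic to $H$. For $d\ge1$, $\mathcal{L}_d$ is the graph obtained from a path $v_0v_1\cdots v_{2d}$ by adding the edges $v_iv_{2d-i}$ for $i\in\{0,\dots,d-1\}$; $\mathcal{Z}_d$ is obtained from $\mathcal{L}_d$ by further adding the edges $v_iv_{2d-1-i}$ for $i\in\{0,\dots,d-2\}$; $\mathcal{Z}^*_d$ is $\mathcal{Z}_d$ with the vertex $v_d$ deleted. For $t\ge3$, $\mathcal{S}_t$ is the set of graphs obtained from a cycle $v_0v_1\cdots v_{t-1}v_0$ by choosing any subset $I\subseteq\{0,\dots,t-1\}$ and, for each $i\in I$, adding a new vertex $r_i$ adjacent exactly to $v_i$ and $v_{i+1}$ (indices modulo $t$). *)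

theory Defs
  imports "HOL-Analysis.Analysis" "Graph_Theory.Graph_Theory"
begin

text \<open>
  Finite simple undirected graphs are the symmetric loop-free finite pair digraphs
  (locale \<^locale>\<open>pair_graph\<close>): an edge \<open>uv\<close> is the pair of arcs \<open>(u,v)\<close>, \<open>(v,u)\<close>.
\<close>

definition k_connected :: "nat \<Rightarrow> ('a,'b) pre_digraph \<Rightarrow> bool" where
  "k_connected k G \<longleftrightarrow> k < card (verts G) \<and>
    (\<forall>X \<subseteq> verts G. card X < k \<longrightarrow> Digraph_Component.connected (G \<restriction> (verts G - X)))"

definition induced_free :: "('c,'d) pre_digraph \<Rightarrow> ('a,'b) pre_digraph \<Rightarrow> bool" where
  "induced_free H G \<longleftrightarrow> \<not> (\<exists>S. induced_subgraph S G \<and> digraph_iso S H)"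

text \<open>
  \<open>H\<close> is (isomorphic to) a minor of \<open>G\<close>: a graph isomorphic to \<open>H\<close> arises from a subgraph of
  \<open>G\<close> by contracting the pairwise disjoint connected branch sets \<open>B x\<close> to single vertices. Note
  that \<^const>\<open>Digraph_Component.connected\<close> entails that branch sets are nonempty.
\<close>

definition minor :: "('c,'d) pre_digraph \<Rightarrow> ('a,'b) pre_digraph \<Rightarrow> bool" where
  "minor H G \<longleftrightarrow> (\<exists>B :: 'c \<Rightarrow> 'a set.
    (\<forall>x \<in> verts H. B x \<subseteq> verts G \<and> Digraph_Component.connected (G \<restriction> B x)) \<and>
    (\<forall>x \<in> verts H. \<forall>y \<in> verts H. x \<noteq> y \<longrightarrow> B x \<inter> B y = {}) \<and>
    (\<forall>(x,y) \<in> arcs_ends H. \<exists>u \<in> B x. \<exists>v \<in> B y. u \<rightarrow>\<^bsub>G\<^esub> v))"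

definition minor_free :: "('c,'d) pre_digraph \<Rightarrow> ('a,'b) pre_digraph \<Rightarrow> bool" where
  "minor_free H G \<longleftrightarrow> \<not> minor H G"

text \<open>
  The vertices are drawn as the distinct points \<open>p v\<close> of the plane, and the edge \<open>uv\<close> as the
  point set \<open>c {u,v}\<close>, an arc between \<open>p u\<close> and \<open>p v\<close>. No arc meets a vertex other than its ends,
  and two different arcs meet only in vertices, hence only in common ends.
\<close>

definition plane_embedding ::
    "'a pair_pre_digraph \<Rightarrow> ('a \<Rightarrow> complex) \<Rightarrow> ('a set \<Rightarrow> complex set) \<Rightarrow> bool" where
  "plane_embedding G p c \<longleftrightarrow>
    inj_on p (pverts G) \<and>
    (\<forall>(u,v) \<in> parcs G.
       (\<exists>g. arc g \<and> path_image g = c {u,v} \<and> pathstart g = p u \<and> pathfinish g = p v) \<and>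
       c {u,v} \<inter> p ` pverts G = {p u, p v}) \<and>
    (\<forall>(u,v) \<in> parcs G. \<forall>(x,y) \<in> parcs G.
       {u,v} \<noteq> {x,y} \<longrightarrow> c {u,v} \<inter> c {x,y} \<subseteq> p ` pverts G)"

definition drawing ::
    "'a pair_pre_digraph \<Rightarrow> ('a \<Rightarrow> complex) \<Rightarrow> ('a set \<Rightarrow> complex set) \<Rightarrow> complex set" where
  "drawing G p c = p ` pverts G \<union> (\<Union>(u,v) \<in> parcs G. c {u,v})"

text \<open>
  As the drawing of a finite graph is compact, its complement has exactly one unbounded
  component, so \<^const>\<open>outside\<close> of the drawing is its outer face.
\<close>

definition outerplanar :: "'a pair_pre_digraph \<Rightarrow> bool" where
  "outerplanar G \<longleftrightarrow> (\<exists>p c. plane_embedding G p c \<and>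
     p ` pverts G \<subseteq> frontier (outside (drawing G p c)))"

definition complete_graph :: "nat \<Rightarrow> nat pair_pre_digraph" where
  "complete_graph n = \<lparr> pverts = {..<n}, parcs = {(i,j). i < n \<and> j < n \<and> i \<noteq> j} \<rparr>"

definition complete_bipartite_graph :: "nat \<Rightarrow> nat \<Rightarrow> nat pair_pre_digraph" where
  "complete_bipartite_graph m n =
    \<lparr> pverts = {..<m+n}, parcs = ({..<m} \<times> {m..<m+n})\<^sup>s \<rparr>"

definition graph_L :: "nat \<Rightarrow> nat pair_pre_digraph" where
  "graph_L d = \<lparr> pverts = {0..2*d},
     parcs = ({(i, i+1) | i. i < 2*d} \<union> {(i, 2*d - i) | i. i < d})\<^sup>s \<rparr>"

text \<open>
  The condition \<open>i + 2 \<le> d\<close> expresses \<open>i \<in> {0,\<dots>,d-2}\<close>, which is empty for \<open>d = 1\<close>.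
\<close>

definition graph_Z :: "nat \<Rightarrow> nat pair_pre_digraph" where
  "graph_Z d = \<lparr> pverts = pverts (graph_L d),
     parcs = parcs (graph_L d) \<union> {(i, 2*d - 1 - i) | i. i + 2 \<le> d}\<^sup>s \<rparr>"

definition graph_Zstar :: "nat \<Rightarrow> (nat, nat \<times> nat) pre_digraph" where
  "graph_Zstar d = pre_digraph.del_vert (with_proj (graph_Z d)) d"

text \<open>
  \<open>Inl i\<close> is the cycle vertex \<open>v\<^sub>i\<close> and \<open>Inr i\<close> the additional vertex \<open>r\<^sub>i\<close>.
\<close>

definition sun_graph :: "nat \<Rightarrow> nat set \<Rightarrow> (nat + nat) pair_pre_digraph" where
  "sun_graph t I = \<lparr> pverts = Inl ` {..<t} \<union> Inr ` I,
     parcs = ({(Inl i, Inl ((i+1) mod t)) | i. i < t} \<union>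
              {(Inr i, Inl i) | i. i \<in> I} \<union>
              {(Inr i, Inl ((i+1) mod t)) | i. i \<in> I})\<^sup>s \<rparr>"

definition graphs_S :: "nat \<Rightarrow> (nat + nat) pair_pre_digraph set" where
  "graphs_S t = {sun_graph t I | I. I \<subseteq> {..<t}}"

lemma complete_graph_K: "K\<^bsub>n\<^esub> (with_proj (complete_graph n))"
  by (auto simp: complete_digraph_pair_def complete_graph_def)

lemma complete_bipartite_graph_K: "K\<^bsub>m,n\<^esub> (with_proj (complete_bipartite_graph m n))"
  unfolding complete_bipartite_digraph_pair_def complete_bipartite_graph_def
proof (intro conjI exI)
  show "pverts \<lparr> pverts = {..<m+n}, parcs = ({..<m} \<times> {m..<m+n})\<^sup>s \<rparr> = {..<m} \<union> {m..<m+n}"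
    by auto
  show "parcs \<lparr> pverts = {..<m+n}, parcs = ({..<m} \<times> {m..<m+n})\<^sup>s \<rparr> =
      {..<m} \<times> {m..<m+n} \<union> {m..<m+n} \<times> {..<m}"
    by (auto simp: symcl_def)
qed auto

lemma pair_graph_Z: "pair_graph (graph_Z d)"
proof -
  have fin: "finite (parcs (graph_Z d))"
    by (rule finite_subset[of _ "{0..2*d} \<times> {0..2*d}"])
       (auto simp: graph_Z_def graph_L_def symcl_def)
  show ?thesis
    by unfold_locales
       (use fin in \<open>auto simp: graph_Z_def graph_L_def symcl_def symmetric_def sym_def\<close>)
qed

lemma pair_graph_S:
  assumes "t \<ge> 3" "H \<in> graphs_S t"
  shows "pair_graph H"
proof -
  obtain I where I: "I \<subseteq> {..<t}" "H = sun_graph t I"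
    using assms(2) by (auto simp: graphs_S_def)
  have "finite I"
    using I(1) finite_subset by blast
  then have fin: "finite (pverts H)"
    by (simp add: I(2) sun_graph_def)
  have sub: "parcs H \<subseteq> pverts H \<times> pverts H"
    using I assms(1) by (auto simp: sun_graph_def symcl_def)
  have loop: "fst e \<noteq> snd e" if "e \<in> parcs H" for e
    using that I assms(1) by (auto simp: sun_graph_def symcl_def mod_Suc split: if_splits)
  show ?thesis
  proof unfold_locales
    show "finite (parcs H)"
      using fin sub by (meson finite_SigmaI finite_subset)
    show "symmetric (with_proj H)"
      by (auto simp: I(2) sun_graph_def symcl_def symmetric_def sym_def)
  qed (use fin sub loop in auto)
qed

lemma digraph_iso_pair_iff:
  assumes "pair_graph G" "pair_graph H"
  shows "digraph_iso (with_proj G) (with_proj H) \<longleftrightarrow>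
    (\<exists>f. bij_betw f (pverts G) (pverts H) \<and>
      (\<forall>u \<in> pverts G. \<forall>v \<in> pverts G. (u,v) \<in> parcs G \<longleftrightarrow> (f u, f v) \<in> parcs H))"
    (is "?L \<longleftrightarrow> ?R")
proof
  interpret G: pair_graph G by fact
  assume ?L
  then obtain h where h: "pre_digraph.digraph_isomorphism (with_proj G) h"
      and H: "with_proj H = app_iso h (with_proj G)"
    by (auto simp: digraph_iso_def)
  let ?f = "iso_verts h"
  have V: "pverts H = ?f ` pverts G"
    using arg_cong[OF H, of verts] by simp
  have A: "parcs H = iso_arcs h ` parcs G"
    using arg_cong[OF H, of arcs] by simp
  have th: "iso_tail h = fst" "iso_head h = snd"
    using arg_cong[OF H, of tail] arg_cong[OF H, of head] by simp_all
  have inj: "inj_on ?f (pverts G)"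
    using h by (simp add: G.digraph_isomorphism_def)
  have A': "iso_arcs h (u,v) = (?f u, ?f v)" if "(u,v) \<in> parcs G" for u v
    using h that th by (auto simp: G.digraph_isomorphism_def intro: prod_eqI)
  have "(u,v) \<in> parcs G \<longleftrightarrow> (?f u, ?f v) \<in> parcs H"
    if uv: "u \<in> pverts G" "v \<in> pverts G" for u v
  proof
    assume "(u,v) \<in> parcs G"
    then show "(?f u, ?f v) \<in> parcs H"
      unfolding A by (rule rev_image_eqI) (simp add: A' \<open>(u,v) \<in> parcs G\<close>)
  next
    assume "(?f u, ?f v) \<in> parcs H"
    then obtain a b where ab: "(a,b) \<in> parcs G" "(?f u, ?f v) = iso_arcs h (a,b)"
      unfolding A by auto
    then have "?f u = ?f a" "?f v = ?f b" "a \<in> pverts G" "b \<in> pverts G"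
      using A'[OF ab(1)] G.wellformed' by auto
    then show "(u,v) \<in> parcs G"
      using ab(1) inj_onD[OF inj] uv by metis
  qed
  then show ?R
    using V inj by (intro exI[of _ ?f]) (auto simp: bij_betw_def)
next
  interpret G: pair_graph G by fact
  interpret H: pair_graph H by fact
  assume ?R
  then obtain f where f: "bij_betw f (pverts G) (pverts H)"
      "\<forall>u \<in> pverts G. \<forall>v \<in> pverts G. (u,v) \<in> parcs G \<longleftrightarrow> (f u, f v) \<in> parcs H"
    by auto
  let ?h = "\<lparr> iso_verts = f, iso_arcs = map_prod f f, iso_head = snd, iso_tail = fst \<rparr>"
  have inj: "inj_on f (pverts G)" and V: "f ` pverts G = pverts H"
    using f(1) by (auto simp: bij_betw_def)
  have "inj_on (map_prod f f) (parcs G)"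
    by (rule inj_on_subset[OF map_prod_inj_on[OF inj inj]]) (auto dest: G.wellformed')
  then have iso: "pre_digraph.digraph_isomorphism (with_proj G) ?h"
    using inj G.wf_digraph_axioms by (auto simp: G.digraph_isomorphism_def)
  have "parcs H \<subseteq> map_prod f f ` parcs G"
  proof
    fix e assume "e \<in> parcs H"
    moreover obtain x y where e: "e = (x,y)" by (cases e)
    ultimately have "x \<in> f ` pverts G" "y \<in> f ` pverts G"
      using V H.wellformed' by auto
    then show "e \<in> map_prod f f ` parcs G"
      using f(2) \<open>e \<in> parcs H\<close> e by force
  qed
  moreover have "(f u, f v) \<in> parcs H" if "(u,v) \<in> parcs G" for u v
    using f(2) G.in_arcsD1[OF that] G.in_arcsD2[OF that] that by blast
  then have "map_prod f f ` parcs G \<subseteq> parcs H"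
    by auto
  ultimately have "with_proj H = app_iso ?h (with_proj G)"
    using V by (auto simp: with_proj_def app_iso_def)
  then show ?L
    using iso by (auto simp: digraph_iso_def)
qed

end

theory Submission
  imports Defs
begin

text \<open>
  A longest cycle is Hamiltonian: if a vertex \<open>x\<close> off the cycle is adjacent to \<open>c\<close>, then
  claw-freeness makes the two cycle neighbours of \<open>c\<close> adjacent, and a walk from \<open>x\<close> back to the
  cycle that avoids \<open>c\<close> yields a longer cycle or a \<open>K\<^sub>4\<close> minor. Two crossing chords of the
  Hamiltonian cycle also yield a \<open>K\<^sub>4\<close> minor, so the chords do not cross, and placing the vertices
  in convex position shows that the graph is outerplanar.

  If some inner face has at least four sides, or three sides none of which lies on the Hamiltonian
  cycle, then claw-freeness allows at most one vertex behind each side, and the graph is in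
  \<open>\<S>\<^sub>t\<close>. Otherwise the chords triangulate the cycle and every triangle has a side on it. Starting
  from a vertex of degree two, claw-freeness then forces the next chord at each step, and the
  chords zigzag as in \<open>\<Z>\<^sub>d\<close> or \<open>\<Z>\<^sup>*\<^sub>d\<close>.
\<close>

section \<open>Walks and cycles as vertex lists\<close>

lemma rtranclp_imp_distinct_walk:
  assumes "r\<^sup>*\<^sup>* x y"
  shows "\<exists>xs. xs \<noteq> [] \<and> hd xs = x \<and> last xs = y \<and> successively r xs \<and> distinct xs"
  using assms
proof (induction rule: rtranclp_induct)
  case base
  show ?case by (rule exI[of _ "[x]"]) simp
next
  case (step y z)
  then obtain xs where xs: "xs \<noteq> []" "hd xs = x" "last xs = y" "successively r xs" "distinct xs"
    by blast
  show ?case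
  proof (cases "z \<in> set xs")
    case True
    then obtain us vs where us: "xs = us @ z # vs" by (meson split_list)
    have "hd (us @ [z]) = x" using xs us by (cases us) auto
    moreover have "successively r (us @ [z])"
      using xs(4) us by (auto simp: successively_append_iff)
    ultimately show ?thesis using xs us by (intro exI[of _ "us @ [z]"]) auto
  next
    case False
    then show ?thesis
      using xs step by (intro exI[of _ "xs @ [z]"]) (auto simp: successively_append_iff)
  qed
qed

lemma successively_rtranclp_hd:
  assumes "successively r xs" "y \<in> set xs"
  shows "r\<^sup>*\<^sup>* (hd xs) y"
  using assms
proof (induction xs)
  case (Cons x xs)
  show ?case
  proof (cases "y = x")
    case False
    then have "y \<in> set xs" "xs \<noteq> []" using Cons.prems by auto
    then show ?thesis
      using Cons by (auto simp: successively_Cons intro: converse_rtranclp_into_rtranclp)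
  qed auto
qed auto

definition cycle :: "('a \<Rightarrow> 'a \<Rightarrow> bool) \<Rightarrow> 'a list \<Rightarrow> bool" where
  "cycle E cs \<longleftrightarrow> 3 \<le> length cs \<and> distinct cs \<and> successively E cs \<and> E (last cs) (hd cs)"

lemma cycle_rotate1: "cycle E cs \<Longrightarrow> cycle E (rotate1 cs)"
  by (cases cs) (auto simp: cycle_def successively_Cons successively_append_iff split: if_splits)

lemma cycle_rotate: "cycle E cs \<Longrightarrow> cycle E (rotate k cs)"
  by (induction k) (auto intro: cycle_rotate1)

lemma cycle_rotate_to_front:
  assumes "cycle E cs" "x \<in> set cs"
  obtains ds where "cycle E (x # ds)" "set (x # ds) = set cs"
proof -
  obtain us vs where us: "cs = us @ x # vs" using assms(2) by (meson split_list)
  have "rotate (length us) cs = x # vs @ us" by (simp add: us rotate_append)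
  with cycle_rotate[OF assms(1), of "length us"] have "cycle E (x # vs @ us)" by simp
  then show thesis by (rule that) (auto simp: us)
qed

section \<open>Longest cycles in 2-connected claw-free graphs without a \<open>K4\<close>
  minor\<close>

text \<open>
  Branch sets of a \<open>K\<^sub>4\<close> minor are only ever needed as vertex sets of walks, so minor-freeness is
  assumed for walks, given as lists.
\<close>

locale claw_K4_free_graph =
  fixes V :: "'a set" and E :: "'a \<Rightarrow> 'a \<Rightarrow> bool"
  assumes fin: "finite V"
    and E_V: "E u v \<Longrightarrow> u \<in> V"
    and E_sym: "E u v \<Longrightarrow> E v u"
    and E_irrefl: "\<not> E u u"
    and claw_free: "\<lbrakk>E a x; E a y; E a z; x \<noteq> y; y \<noteq> z; x \<noteq> z\<rbrakk> \<Longrightarrow> E x y \<or> E y z \<or> E x z"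
    and K4_minor_free: "\<lbrakk>A \<noteq> []; B \<noteq> []; C \<noteq> []; D \<noteq> [];
      successively E A; successively E B; successively E C; successively E D;
      distinct (A @ B @ C @ D);
      \<exists>a\<in>set A. \<exists>b\<in>set B. E a b; \<exists>a\<in>set A. \<exists>b\<in>set C. E a b; \<exists>a\<in>set A. \<exists>b\<in>set D. E a b;
      \<exists>a\<in>set B. \<exists>b\<in>set C. E a b; \<exists>a\<in>set B. \<exists>b\<in>set D. E a b; \<exists>a\<in>set C. \<exists>b\<in>set D. E a b\<rbrakk> \<Longrightarrow> False"
    and card_V: "3 \<le> card V"
    and walk_avoiding: "\<lbrakk>v \<in> V; x \<in> V - {v}; y \<in> V - {v}\<rbrakk> \<Longrightarrow>
      \<exists>xs. xs \<noteq> [] \<and> hd xs = x \<and> last xs = y \<and> successively E xs \<and> distinct xs \<and> v \<notin> set xs"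
begin

lemma E_comm: "E u v \<longleftrightarrow> E v u"
  using E_sym by blast

lemma E_V2: "E u v \<Longrightarrow> v \<in> V"
  using E_V E_sym by blast

lemma successively_rev_E: "successively E (rev xs) = successively E xs"
  by (simp add: E_comm)

lemma other_vertex: "\<exists>z\<in>V. z \<noteq> x \<and> z \<noteq> y"
proof (rule ccontr)
  assume "\<not> ?thesis"
  then have "V \<subseteq> {x, y}" by auto
  then have "card V \<le> card {x, y}" by (intro card_mono) auto
  also have "\<dots> \<le> 2" by (simp add: card_insert_le_m1)
  finally show False using card_V by simp
qed

text \<open>The second vertex of a walk from \<open>u\<close> to a third vertex that avoids
  \<open>v\<close>. This is minimum degree two in the form that \<open>cycle_exists\<close>
  uses.\<close>

lemma neighbour_avoiding:
  assumes "u \<in> V" "v \<in> V" "u \<noteq> v"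
  shows "\<exists>w. E u w \<and> w \<noteq> v"
proof -
  obtain z where z: "z \<in> V" "z \<noteq> u" "z \<noteq> v" using other_vertex by blast
  obtain xs where xs: "xs \<noteq> []" "hd xs = u" "last xs = z" "successively E xs" "v \<notin> set xs"
    using walk_avoiding[of v u z] assms z by auto
  then obtain ys where ys: "xs = u # ys" by (cases xs) auto
  with xs z have "ys \<noteq> []" by auto
  then show ?thesis using xs ys by (intro exI[of _ "hd ys"]) (auto simp: successively_Cons)
qed

lemma cycle_subset:
  assumes "cycle E cs"
  shows "set cs \<subseteq> V"
proof
  fix x assume "x \<in> set cs"
  then obtain ds where "cycle E (x # ds)" by (meson assms cycle_rotate_to_front)
  then have "E (last (x # ds)) x" by (simp add: cycle_def)
  then show "x \<in> V" by (rule E_V2)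
qed

text \<open>Two neighbours of \<open>u\<close> are joined by a walk avoiding \<open>u\<close>, which
  closes up through \<open>u\<close>.\<close>

lemma cycle_exists: "\<exists>cs. cycle E cs"
proof -
  obtain u where u: "u \<in> V" using other_vertex by blast
  obtain u' where "u' \<in> V" "u' \<noteq> u" using other_vertex by blast
  then obtain v where v: "E u v" using neighbour_avoiding u by blast
  then have "v \<in> V" "v \<noteq> u" using E_V2 E_irrefl by auto
  then obtain w where w: "E u w" "w \<noteq> v" using neighbour_avoiding u by blast
  then have "w \<in> V" "w \<noteq> u" using E_V2 E_irrefl by auto
  with v \<open>v \<in> V\<close> \<open>v \<noteq> u\<close> u obtain xs where xs: "xs \<noteq> []" "hd xs = v" "last xs = w"
      "successively E xs" "distinct xs" "u \<notin> set xs"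
    using walk_avoiding[of u v w] by auto
  have "2 \<le> length xs"
  proof (rule ccontr)
    assume "\<not> ?thesis"
    then obtain a where "xs = [a]" using xs(1) by (cases xs; cases "tl xs") auto
    then show False using xs w by simp
  qed
  then have "cycle E (u # xs)"
    using xs v E_sym[OF w(1)] by (auto simp: cycle_def successively_Cons)
  then show ?thesis by blast
qed

text \<open>Write the cycle as \<open>c # ds\<close> with \<open>x\<close> off it and adjacent to
  \<open>c\<close>. A walk from \<open>x\<close> avoiding \<open>c\<close> first meets
  \<open>ds\<close> in some \<open>r\<close>. If \<open>r\<close> is an end of \<open>ds\<close>,
  the walk can be inserted next to \<open>c\<close> and the cycle grows; if \<open>r\<close> is
  inside \<open>ds\<close>, the chord between the two ends of \<open>ds\<close> completes a
  \<open>K4\<close> minor.\<close>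

lemma longest_cycle_spans:
  assumes cs: "cycle E cs" and longest: "\<And>ds. cycle E ds \<Longrightarrow> length ds \<le> length cs"
  shows "set cs = V"
proof (rule ccontr)
  assume "set cs \<noteq> V"
  with cycle_subset[OF cs] obtain y where y: "y \<in> V" "y \<notin> set cs" by auto
  have len: "length ds = length cs" if "cycle E ds" "set ds = set cs" for ds
    using that cs by (metis cycle_def distinct_card)
  have "\<exists>c x. c \<in> set cs \<and> x \<notin> set cs \<and> E c x"
  proof -
    obtain c c' cs' where c: "cs = c # c' # cs'" 
      using cs by (cases cs; cases "tl cs") (auto simp: cycle_def)
    then have "c \<in> V - {c'}" "c' \<in> V" "y \<in> V - {c'}" using cs cycle_subset[OF cs] y
      by (auto simp: cycle_def)
    then obtain xs where xs: "xs \<noteq> []" "hd xs = c" "last xs = y" "successively E xs"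
      using walk_avoiding[of c' c y] by blast
    have "successively E xs \<Longrightarrow> hd xs \<in> set cs \<Longrightarrow> last xs \<notin> set cs \<Longrightarrow> xs \<noteq> [] \<Longrightarrow> ?thesis" for xs
      by (induction xs) (auto simp: successively_Cons split: if_splits)
    then show ?thesis using xs y c by auto
  qed
  then obtain c x where c: "c \<in> set cs" and x: "x \<notin> set cs" "E c x" by blast
  obtain ds where ds: "cycle E (c # ds)" "set (c # ds) = set cs"
    using cycle_rotate_to_front[OF cs c] .
  have lends: "length (c # ds) = length cs" using len ds by blast
  have dsne: "ds \<noteq> []" and dist: "distinct (c # ds)" and suc: "successively E (c # ds)"
    and ld: "E (last ds) c" and hdc: "E c (hd ds)" and l2: "2 \<le> length ds"
    using ds(1) by (auto simp: cycle_def successively_Cons split: if_splits)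
  have xc: "x \<noteq> c" "x \<notin> set ds" using x ds by auto
  have not_longer: False if "cycle E zs" "length ds + 1 < length zs" for zs
    using longest[OF that(1)] that(2) lends by simp
  \<comment> \<open>Otherwise \<open>x\<close> could be inserted between \<open>c\<close> and its
    cycle neighbour, here and in \<open>xr\<close>.\<close>
  have xl: "\<not> E x (hd ds)"
    using not_longer[of "c # x # ds"] suc dist xc x(2) ld dsne l2
    by (auto simp: cycle_def successively_Cons)
  have xr: "\<not> E x (last ds)"
    using not_longer[of "c # ds @ [x]"] suc dist xc x(2) E_sym[OF x(2)] E_comm[of "last ds" x] ld dsne l2
    by (auto simp: cycle_def successively_Cons successively_append_iff)
  have hl: "hd ds \<noteq> last ds"
    using l2 dist by (cases ds) (auto split: if_splits)
  \<comment> \<open>The claw at \<open>c\<close> with leaves \<open>hd ds\<close>,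
    \<open>last ds\<close> and \<open>x\<close> leaves only this pair.\<close>
  have chord: "E (hd ds) (last ds)"
    using claw_free[of c "hd ds" "last ds" x] hdc E_sym[OF ld] x(2) xl xr hl xc dsne E_comm[of x]
    by (metis last_in_set hd_in_set)
  have "x \<in> V - {c}" "hd ds \<in> V - {c}" "c \<in> V"
    using x(2) E_V E_V2 xc hdc dist dsne by auto
  then obtain xs where xs: "xs \<noteq> []" "hd xs = x" "last xs = hd ds" "successively E xs"
      "distinct xs" "c \<notin> set xs"
    using walk_avoiding[of c x "hd ds"] by blast
  \<comment> \<open>\<open>P\<close> is the part of the walk before its first vertex
    \<open>r\<close> on \<open>ds\<close>; \<open>us\<close> and \<open>ws\<close> below are the
    parts of \<open>ds\<close> before and after \<open>r\<close>.\<close>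
  define P where "P = takeWhile (\<lambda>z. z \<notin> set ds) xs"
  define r where "r = hd (dropWhile (\<lambda>z. z \<notin> set ds) xs)"
  have "last xs \<in> set ds" using xs dsne by simp
  then have ne: "dropWhile (\<lambda>z. z \<notin> set ds) xs \<noteq> []"
    using xs(1) by (metis dropWhile_eq_Nil_conv last_in_set)
  then have rds: "r \<in> set ds" unfolding r_def using hd_dropWhile by blast
  have Pne: "P \<noteq> []" and hdP: "hd P = x"
    using xs xc by (cases xs; auto simp: P_def)+
  obtain T where split: "xs = P @ r # T"
    unfolding P_def r_def using ne by (metis list.collapse takeWhile_dropWhile_id)
  have sP: "successively E P" and lP: "E (last P) r" and dP: "distinct P" and cP: "c \<notin> set P"
    using xs(4-6) Pne unfolding split by (auto simp: successively_append_iff)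
  have Pds: "set P \<inter> set ds = {}" unfolding P_def by (auto dest: set_takeWhileD)
  obtain us ws where uw: "ds = us @ r # ws" using rds by (meson split_list)
  have "us \<noteq> []"
  proof
    assume "us = []"
    then have "cycle E (c # P @ ds)"
      using suc dist ld dsne l2 sP lP dP cP Pds Pne uw hdP x(2)
      by (auto simp: cycle_def successively_Cons successively_append_iff)
    then show False using not_longer[of "c # P @ ds"] Pne by (cases P) auto
  qed
  have "ws \<noteq> []"
  proof
    assume "ws = []"
    then have ds': "ds = us @ [r]" using uw by simp
    have "E c (last (rev P))" "E r (hd (rev P))"
      using x(2) E_sym[OF lP] hdP Pne by (auto simp: hd_rev last_rev)
    moreover have "successively E (rev P)" using sP successively_rev_E by blast
    ultimately have "cycle E (c # ds @ rev P)"
      using suc dist l2 dP cP Pds Pne \<open>us \<noteq> []\<close> E_sym[of c "last (rev P)"] unfolding ds' cycle_def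
      by (simp add: successively_Cons successively_append_iff Int_commute del: successively_rev)
    then show False using not_longer[of "c # ds @ rev P"] Pne by (cases P) auto
  qed
  show False
  \<comment> \<open>\<open>c\<close> sees the outer ends of \<open>us\<close> and \<open>ws\<close>,
    \<open>P\<close> leads to \<open>r\<close>, \<open>r\<close> sees the inner ends of
    \<open>us\<close> and \<open>ws\<close>, and \<open>chord\<close> joins \<open>us\<close> to
    \<open>ws\<close>.\<close>
  proof (rule K4_minor_free[of "c # P" us "[r]" ws])
    show "distinct ((c # P) @ us @ [r] @ ws)"
      using dist cP dP Pds uw by auto
    show "\<exists>a\<in>set (c # P). \<exists>b\<in>set us. E a b"
      using hdc uw \<open>us \<noteq> []\<close> by (intro bexI[of _ c] bexI[of _ "hd us"]) auto
    show "\<exists>a\<in>set (c # P). \<exists>b\<in>set [r]. E a b"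
      using lP Pne by (intro bexI[of _ "last P"] bexI[of _ r]) auto
    show "\<exists>a\<in>set (c # P). \<exists>b\<in>set ws. E a b"
      using E_sym[OF ld] uw \<open>ws \<noteq> []\<close> by (intro bexI[of _ c] bexI[of _ "last ws"]) auto
    show "\<exists>a\<in>set us. \<exists>b\<in>set [r]. E a b"
      using suc uw \<open>us \<noteq> []\<close>
      by (intro bexI[of _ "last us"] bexI[of _ r]) (auto simp: successively_Cons successively_append_iff)
    show "\<exists>a\<in>set us. \<exists>b\<in>set ws. E a b"
      using chord uw \<open>us \<noteq> []\<close> \<open>ws \<noteq> []\<close> by (intro bexI[of _ "hd us"] bexI[of _ "last ws"]) auto
    show "\<exists>a\<in>set [r]. \<exists>b\<in>set ws. E a b"
      using suc uw \<open>us \<noteq> []\<close> \<open>ws \<noteq> []\<close>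
      by (intro bexI[of _ r] bexI[of _ "hd ws"]) (auto simp: successively_Cons successively_append_iff)
    show "successively E (c # P)" using sP x(2) hdP by (simp add: successively_Cons)
    show "successively E us" "successively E ws"
      using suc unfolding uw by (auto simp: successively_Cons successively_append_iff)
  qed (use \<open>us \<noteq> []\<close> \<open>ws \<noteq> []\<close> in simp_all)
qed

lemma Hamiltonian: "\<exists>cs. cycle E cs \<and> set cs = V"
proof -
  obtain cs0 where cs0: "cycle E cs0" using cycle_exists by blast
  have bound: "\<forall>cs. cycle E cs \<longrightarrow> length cs < Suc (card V)"
    using card_mono[OF fin cycle_subset] by (auto simp: cycle_def distinct_card less_Suc_eq_le)
  obtain cs where "cycle E cs" "\<forall>ds. cycle E ds \<longrightarrow> length ds \<le> length cs"
    using ex_has_greatest_nat[OF cs0 bound] by blast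
  then show ?thesis using longest_cycle_spans by blast
qed

end

section \<open>Hamiltonian cycles with integer labels, and zigzag triangulations\<close>

lemma successively_upto:
  assumes "\<And>k. i \<le> k \<Longrightarrow> k < j \<Longrightarrow> r k (k + 1)"
  shows "successively r [i..j]"
  using assms[of "i + int k" for k] by (auto simp: successively_conv_nth ac_simps)

text \<open>
  A Hamiltonian cycle is given by a labelling \<open>c\<close> of its vertices by all integers with period
  \<open>n\<close>. Rotations and reflections of the cycle then are translations and reflections of the
  integers, and no index ever has to be reduced modulo \<open>n\<close>.
\<close>

locale outerplanar_labelling =
  fixes E :: "'a \<Rightarrow> 'a \<Rightarrow> bool" and c :: "int \<Rightarrow> 'a" and n :: int
  assumes n3: "3 \<le> n"
    and c_period: "c (i + n) = c i"
    and c_inj: "\<lbrakk>i < j; j < i + n\<rbrakk> \<Longrightarrow> c i \<noteq> c j"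
    and sym_E: "E u v \<Longrightarrow> E v u"
    and irrefl_E: "\<not> E u u"
    and cycle_edge: "E (c i) (c (i + 1))"
    and claw: "\<lbrakk>E a x; E a y; E a z; x \<noteq> y; y \<noteq> z; x \<noteq> z\<rbrakk> \<Longrightarrow> E x y \<or> E y z \<or> E x z"
    and noncrossing: "\<lbrakk>i < j; j < k; k < l; l < i + n; E (c i) (c k); E (c j) (c l)\<rbrakk> \<Longrightarrow> False"
begin

abbreviation Q :: "int \<Rightarrow> int \<Rightarrow> bool" where
  "Q i j \<equiv> E (c i) (c j)"

lemma Q_comm: "Q i j \<longleftrightarrow> Q j i"
  using sym_E by blast

lemma c_period_nat: "c (i + n * int m) = c i"
proof (induction m)
  case (Suc m)
  have "i + n * int (Suc m) = i + n * int m + n" by (simp add: algebra_simps)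
  then show ?case using Suc c_period by metis
qed simp

lemma c_period_int: "c (i + n * m) = c i"
proof (cases "0 \<le> m")
  case True
  then show ?thesis using c_period_nat[of i "nat m"] by simp
next
  case False
  then show ?thesis using c_period_nat[of "i + n * m" "nat (- m)"] by simp
qed

lemma bij_betw_window: "bij_betw c {m..<m + n} (range c)"
proof (rule bij_betw_imageI)
  show "inj_on c {m..<m + n}"
    by (rule linorder_inj_onI) (use c_inj in force)+
  have "c i \<in> c ` {m..<m + n}" for i
  proof (rule image_eqI)
    let ?r = "m + (i - m) mod n"
    have "i = ?r + n * ((i - m) div n)" by simp
    then show "c i = c ?r" using c_period_int by metis
    show "?r \<in> {m..<m + n}" using n3 by simp
  qed
  then show "c ` {m..<m + n} = range c" by auto
qed

text \<open>The cyclic order of the labels supplies the distinctness of the three leaves.\<close>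

lemma claw_cyclic:
  assumes "x < y" "y < z" "z < x + n" "Q a x" "Q a y" "Q a z"
  shows "Q x y \<or> Q y z \<or> Q x z"
  using assms by (intro claw[of "c a"] c_inj) auto

lemma labelling_shift: "outerplanar_labelling E (\<lambda>i. c (i + m)) n"
proof
  show "c (i + n + m) = c (i + m)" for i
    using c_period[of "i + m"] by (simp add: algebra_simps)
  show "E (c (i + m)) (c (i + 1 + m))" for i
    using cycle_edge[of "i + m"] by (simp add: algebra_simps)
  show False if "i < j" "j < k" "k < l" "l < i + n" "E (c (i + m)) (c (k + m))"
      "E (c (j + m)) (c (l + m))" for i j k l
    using noncrossing[of "i + m" "j + m" "k + m" "l + m"] that by simp
qed (use n3 c_inj sym_E irrefl_E claw in auto)

lemma labelling_reflect: "outerplanar_labelling E (\<lambda>i. c (m - i)) n"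
proof
  show "c (m - (i + n)) = c (m - i)" for i
    using c_period[of "m - (i + n)"] by simp
  show "c (m - i) \<noteq> c (m - j)" if "i < j" "j < i + n" for i j
    using c_inj[of "m - j" "m - i"] that by auto
  show "E (c (m - i)) (c (m - (i + 1)))" for i
    using cycle_edge[of "m - (i + 1)"] Q_comm by simp
  show False if "i < j" "j < k" "k < l" "l < i + n" "E (c (m - i)) (c (m - k))"
      "E (c (m - j)) (c (m - l))" for i j k l
    using noncrossing[of "m - l" "m - k" "m - j" "m - i"] that Q_comm by simp
qed (use n3 sym_E irrefl_E claw in auto)

text \<open>The assumptions say that \<open>n - 1\<close> is the tip of an ear and that the next
  triangle has its apex at 1. From there the two ends of the chord move inwards alternately: at the
  end just reached, its two cycle neighbours and the other end of the chord would form a claw, and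
  two of the three possible edges among them cross chords already found.\<close>

lemma zigzag_chords:
  assumes Q0: "Q 0 (n - 2)" and Q1: "4 \<le> n \<Longrightarrow> Q 1 (n - 2)"
  shows "(int j < n - 2 - int j \<longrightarrow> Q (int j) (n - 2 - int j)) \<and>
    (int j + 1 < n - 2 - int j \<longrightarrow> Q (int j + 1) (n - 2 - int j))"
proof (induction j)
  case 0
  show ?case using Q0 Q1 by auto
next
  case (Suc j)
  define m where "m = int j + 1"
  have m1: "1 \<le> m" by (simp add: m_def)
  show ?case
  proof (cases "m < n - 2 - m")
    case True
    have A: "Q (m - 1) (n - 1 - m)" and B: "Q m (n - 1 - m)"
      using Suc True by (auto simp: m_def algebra_simps)
    \<comment> \<open>The claw at \<open>n - 1 - m\<close>: both excluded edges end in
      \<open>n - m\<close> and would cross \<open>A\<close>.\<close>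
    have "Q (n - 1 - m) (n - m)" using cycle_edge[of "n - 1 - m"] by simp
    moreover have "Q (n - 1 - m) (n - 2 - m)" using cycle_edge[of "n - 2 - m"] Q_comm by (simp add: algebra_simps)
    moreover have "\<not> Q m (n - m)"
      using noncrossing[of "m - 1" m "n - 1 - m" "n - m"] A True m1 by auto
    moreover have "\<not> Q (n - 2 - m) (n - m)"
      using noncrossing[of "m - 1" "n - 2 - m" "n - 1 - m" "n - m"] A True m1 by auto
    ultimately have A': "Q m (n - 2 - m)"
      using claw_cyclic[of m "n - 2 - m" "n - m" "n - 1 - m"] B Q_comm True by (auto simp: m_def)
    moreover have "Q (m + 1) (n - 2 - m)" if "m + 1 < n - 2 - m"
    proof -
      \<comment> \<open>The claw at \<open>m\<close>: both excluded edges end in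
        \<open>m - 1\<close>; one would cross the new chord \<open>A'\<close>, the other
        \<open>B\<close>.\<close>
      have "\<not> Q (m - 1) (m + 1)"
        using noncrossing[of "m - 1" m "m + 1" "n - 2 - m"] A' that by (auto simp: m_def)
      moreover have "\<not> Q (m - 1) (n - 2 - m)"
        using noncrossing[of "m - 1" m "n - 2 - m" "n - 1 - m"] B that by (auto simp: m_def)
      moreover have "Q m (m - 1)" using cycle_edge[of "m - 1"] Q_comm by simp
      ultimately show ?thesis
        using claw_cyclic[of "m - 1" "m + 1" "n - 2 - m" m] cycle_edge[of m] A' that
        by (auto simp: m_def)
    qed
    ultimately show ?thesis by (auto simp: m_def algebra_simps)
  qed (auto simp: m_def)
qed

text \<open>Any further chord would cross a zigzag chord: the one from \<open>i + 1\<close> to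
  \<open>n - 2 - i\<close> if \<open>i + j\<close> is too small, the one from
  \<open>n - 1 - j\<close> to \<open>j - 1\<close> if it is too large.\<close>

lemma zigzag_adjacency:
  assumes Q0: "Q 0 (n - 2)" and Q1: "4 \<le> n \<Longrightarrow> Q 1 (n - 2)"
    and ij: "0 \<le> i" "i < j" "j < n"
  shows "Q i j \<longleftrightarrow> j = i + 1 \<or> i + j = n - 1 \<or> i + j = n - 2"
proof -
  have A: "Q m (n - 2 - m)" if "0 \<le> m" "m < n - 2 - m" for m
    using zigzag_chords[OF Q0 Q1, of "nat m"] that by auto
  have B: "Q m (n - 1 - m)" if "1 \<le> m" "m < n - 1 - m" for m
    using zigzag_chords[OF Q0 Q1, of "nat (m - 1)"] that by (auto simp: algebra_simps)
  \<comment> \<open>\<open>B\<close> starts at 1. The remaining pair of sum \<open>n - 1\<close> is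
    the closing edge of the cycle, since -1 and \<open>n - 1\<close> label the same vertex.\<close>
  have C: "Q 0 (n - 1)"
    using cycle_edge[of "-1"] c_period[of "-1"] Q_comm by (simp add: add.commute)
  show ?thesis
  proof
    assume q: "Q i j"
    show "j = i + 1 \<or> i + j = n - 1 \<or> i + j = n - 2"
    proof (rule ccontr)
      assume "\<not> ?thesis"
      then consider "i + 1 < j" "i + j \<le> n - 3" | "i + 1 < j" "n \<le> i + j" using ij by linarith
      then show False
      proof cases
        case 1
        then show ?thesis
          using noncrossing[of i "i + 1" j "n - 2 - i"] B[of "i + 1"] q ij by (auto simp: algebra_simps)
      next
        case 2
        then show ?thesis
          using noncrossing[of "n - 1 - j" i "j - 1" j] A[of "n - 1 - j"] q ij by auto
      qed
    qed
  next
    assume "j = i + 1 \<or> i + j = n - 1 \<or> i + j = n - 2"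
    then consider "j = i + 1" | "j = n - 1 - i" | "j = n - 2 - i" by linarith
    then show "Q i j"
    proof cases
      case 2
      then show ?thesis using B[of i] C ij by (cases "i = 0") auto
    qed (use cycle_edge A ij in auto)
  qed
qed

text \<open>The closing edge from 0 to \<open>n - 1\<close> counts as a chord over all other
  vertices. An apex splits a chord into two, one of which still spans at least two unless the chord
  itself spans exactly two, so the descent ends in an ear.\<close>

lemma ear_exists:
  assumes tri: "\<And>i j. \<lbrakk>i + 2 \<le> j; j < i + n; Q i j\<rbrakk> \<Longrightarrow> \<exists>k. i < k \<and> k < j \<and> Q i k \<and> Q k j"
  shows "\<exists>m. Q m (m + 2)"
proof -
  have *: "i + 2 \<le> j \<Longrightarrow> j < i + n \<Longrightarrow> Q i j \<Longrightarrow> ?thesis" for i j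
  proof (induction "nat (j - i)" arbitrary: i j rule: less_induct)
    case less
    show ?case
    proof (cases "j = i + 2")
      case False
      obtain k where k: "i < k" "k < j" "Q i k" "Q k j" using tri less.prems by blast
      then consider "i + 2 \<le> k" | "k + 2 \<le> j" using False less.prems by linarith
      then show ?thesis
        by cases (use less.hyps[of k i] less.hyps[of j k] k less.prems in auto)
    qed (use less.prems in auto)
  qed
  have "Q 0 (n - 1)"
    using cycle_edge[of "-1"] c_period[of "-1"] Q_comm by (simp add: add.commute)
  then show ?thesis using *[of 0 "n - 1"] n3 by simp
qed

text \<open>By \<open>no_inner\<close>, the triangle behind the base of an ear has its apex next to
  one end of the base. A shift, or a reflection if the apex is at the other end, brings this into
  the position of \<open>zigzag_adjacency\<close>.\<close>

lemma triangulated_imp_zigzag: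
  assumes tri: "\<And>i j. \<lbrakk>i + 2 \<le> j; j < i + n; Q i j\<rbrakk> \<Longrightarrow> \<exists>k. i < k \<and> k < j \<and> Q i k \<and> Q k j"
    and no_inner: "\<And>i k j. \<lbrakk>i + 2 \<le> k; k + 2 \<le> j; j + 2 \<le> i + n; Q i k; Q k j; Q i j\<rbrakk> \<Longrightarrow> False"
  shows "\<exists>b. bij_betw b {0..<n} (range c) \<and> (\<forall>i j. 0 \<le> i \<longrightarrow> i < j \<longrightarrow> j < n \<longrightarrow>
    (E (b i) (b j) \<longleftrightarrow> j = i + 1 \<or> i + j = n - 1 \<or> i + j = n - 2))"
    (is "\<exists>b. ?P b")
proof -
  have zigzag: "?P b" if b: "outerplanar_labelling E b n" "range b = range c"
    "E (b 0) (b (n - 2))" "4 \<le> n \<Longrightarrow> E (b 1) (b (n - 2))" for b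
  proof -
    interpret b: outerplanar_labelling E b n by fact
    have "bij_betw b {0..<n} (range c)" using b.bij_betw_window[of 0] b(2) by simp
    then show ?thesis using b.zigzag_adjacency[OF b(3,4)] by blast
  qed
  obtain m0 where m0: "Q m0 (m0 + 2)" using ear_exists[OF tri] by blast
  \<comment> \<open>Counting from \<open>m\<close>, the ear tip \<open>m0 + 1\<close> gets the label
    \<open>n - 1\<close>, and the base joins 0 to \<open>n - 2\<close>.\<close>
  define m where "m = m0 + 2"
  have Qm: "Q m (m + n - 2)"
    using m0 c_period[of m0] Q_comm by (simp add: m_def algebra_simps)
  have range_shift: "range (\<lambda>i. c (i + k)) = range c" for k
    by (auto simp: image_iff) (metis diff_add_cancel)
  have range_reflect: "range (\<lambda>i. c (k - i)) = range c" for k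
    by (auto simp: image_iff) (metis add_diff_cancel_left' diff_diff_eq2 diff_add_cancel)
  consider "n = 3" | "4 \<le> n" "Q (m + 1) (m + n - 2)" | "5 \<le> n" "Q m (m + n - 3)"
  proof -
    consider "n = 3" | "n = 4" | "5 \<le> n" using n3 by linarith
    then show thesis
    proof cases
      case 2
      then show ?thesis using that(2) cycle_edge[of "m + 1"] by simp
    next
      case 3
      obtain k where k: "m < k" "k < m + n - 2" "Q m k" "Q k (m + n - 2)"
        using tri[OF _ _ Qm] 3 by auto
      have "k = m + 1 \<or> k = m + n - 3"
        using no_inner[of m k "m + n - 2"] k Qm by force
      then show ?thesis using that(2,3) 3 k by auto
    qed (use that in auto)
  qed
  then show ?thesis
  proof cases
    case 1
    then show ?thesis
      using zigzag[OF labelling_shift range_shift, of m] Qm by (auto simp: algebra_simps)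
  next
    case 2
    then show ?thesis
      using zigzag[OF labelling_shift range_shift, of m] Qm by (auto simp: algebra_simps)
  next
    case 3
    then show ?thesis
      \<comment> \<open>The reflection exchanges the ends of the base, so that the apex
        \<open>m + n - 3\<close> gets the label 1.\<close>
      using zigzag[OF labelling_reflect range_reflect, of "m + n - 2"] Qm Q_comm
      by (auto simp: algebra_simps)
  qed
qed

end

section \<open>From a Hamiltonian cycle to a labelling without crossing chords\<close>

context claw_K4_free_graph
begin

text \<open>The labels read the Hamiltonian cycle modulo its length. The ends of two crossing chords
  cut the cycle into four arcs, which are branch sets of a \<open>K4\<close> minor: cyclically
  consecutive arcs are joined by cycle edges, opposite arcs by the chords.\<close>

lemma outerplanar_labelling_exists:
  "\<exists>c n. outerplanar_labelling E c n \<and> range c = V"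
proof -
  obtain cs where cs: "cycle E cs" "set cs = V" using Hamiltonian by blast
  define n where "n = int (length cs)"
  define c where "c i = cs ! nat (i mod n)" for i
  have n3: "3 \<le> n" using cs(1) by (simp add: cycle_def n_def)
  have period: "c (i + n) = c i" for i by (simp add: c_def)
  have bound: "nat (i mod n) < length cs" for i
  proof -
    have "0 \<le> i mod n" "i mod n < n" using n3 by auto
    then show ?thesis unfolding n_def by linarith
  qed
  have dist: "distinct cs" using cs(1) by (simp add: cycle_def)
  have inj: "c i \<noteq> c j" if "i < j" "j < i + n" for i j
  proof
    assume "c i = c j"
    then have "nat (i mod n) = nat (j mod n)"
      using nth_eq_iff_index_eq[OF dist bound bound] by (simp add: c_def)
    then have "i mod n = j mod n" using n3 by (simp add: nat_eq_iff2)
    then have "n dvd j - i" by (metis mod_eq_dvd_iff)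
    then show False using that zdvd_imp_le[of n "j - i"] by auto
  qed
  have edge: "E (c i) (c (i + 1))" for i
  proof (cases "i mod n = n - 1")
    case True
    then have "(i + 1) mod n = 0" by (metis diff_add_cancel mod_add_left_eq mod_self)
    moreover have "cs \<noteq> []" using n3 by (auto simp: n_def)
    moreover have "nat (n - 1) = length cs - 1" unfolding n_def by linarith
    ultimately have "c (i + 1) = hd cs" "c i = last cs"
      using True by (auto simp: c_def hd_conv_nth last_conv_nth)
    then show ?thesis using cs(1) by (simp add: cycle_def)
  next
    case False
    have "0 \<le> i mod n" "i mod n < n" using n3 by auto
    with False have lt: "i mod n + 1 < n" by linarith
    then have "(i + 1) mod n = i mod n + 1"
      using n3 by (metis mod_add_left_eq mod_pos_pos_trivial \<open>0 \<le> i mod n\<close> add_nonneg_nonneg zero_le_one)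
    then have "c (i + 1) = cs ! Suc (nat (i mod n))" "Suc (nat (i mod n)) < length cs"
      using \<open>0 \<le> i mod n\<close> lt by (auto simp: c_def n_def nat_add_distrib)
    then show ?thesis using cs(1) by (auto simp: c_def cycle_def successively_conv_nth)
  qed
  have "range c = V"
  proof -
    have "\<exists>i. x = c i" if x: "x \<in> set cs" for x
    proof -
      obtain k where "k < length cs" "x = cs ! k" using x by (auto simp: in_set_conv_nth)
      moreover from this have "int k mod n = int k"
        unfolding n_def by (intro mod_pos_pos_trivial) auto
      ultimately have "x = c (int k)" by (simp add: c_def)
      then show ?thesis ..
    qed
    moreover have "c i \<in> set cs" for i using bound by (simp add: c_def)
    ultimately show ?thesis using cs(2) by auto
  qed
  moreover have "outerplanar_labelling E c n"
  proof
    fix i j k l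
    assume ord: "i < j" "j < k" "k < l" "l < i + n" and ik: "E (c i) (c k)" and jl: "E (c j) (c l)"
    \<comment> \<open>Each arc contains its first end but not its last, so that the four arcs
      partition the cycle.\<close>
    let ?arc = "\<lambda>x y. map c [x..y - 1]"
    have suc: "successively E (?arc x y)" for x y
      by (auto simp: successively_map intro!: successively_upto edge)
    have "inj_on c {i..i + n - 1}"
      by (rule linorder_inj_onI) (use inj in force)+
    moreover have "[i..i + n - 1] = [i..j - 1] @ [j..k - 1] @ [k..l - 1] @ [l..i + n - 1]"
      using ord upto_split1[of i j "i + n - 1"] upto_split1[of j k "i + n - 1"]
        upto_split1[of k l "i + n - 1"] by simp
    ultimately have "distinct (map c ([i..j - 1] @ [j..k - 1] @ [k..l - 1] @ [l..i + n - 1]))"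
      by (metis distinct_map distinct_upto set_upto)
    then have dist': "distinct (?arc i j @ ?arc j k @ ?arc k l @ ?arc l (i + n))" by simp
    have join: "\<exists>a\<in>set (?arc x y). \<exists>b\<in>set (?arc y z). E a b" if "x < y" "y < z" for x y z
      using that edge[of "y - 1"] by (intro bexI[of _ "c (y - 1)"] bexI[of _ "c y"]) auto
    show False
    proof (rule K4_minor_free[of "?arc i j" "?arc j k" "?arc k l" "?arc l (i + n)"])
      show "\<exists>a\<in>set (?arc i j). \<exists>b\<in>set (?arc k l). E a b"
        using ord ik by (intro bexI[of _ "c i"] bexI[of _ "c k"]) auto
      show "\<exists>a\<in>set (?arc j k). \<exists>b\<in>set (?arc l (i + n)). E a b"
        using ord jl by (intro bexI[of _ "c j"] bexI[of _ "c l"]) auto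
      have "E (c i) (c (i + n - 1))"
        using edge[of "i + n - 1"] period[of i] E_sym by simp
      then show "\<exists>a\<in>set (?arc i j). \<exists>b\<in>set (?arc l (i + n)). E a b"
        using ord by (intro bexI[of _ "c i"] bexI[of _ "c (i + n - 1)"]) auto
    qed (rule suc dist' join ord | use ord in simp)+
  next
    show "E x y \<or> E y z \<or> E x z" if "E a x" "E a y" "E a z" "x \<noteq> y" "y \<noteq> z" "x \<noteq> z" for a x y z
      using claw_free that by blast
  qed (assumption | rule n3 period inj E_irrefl edge E_sym)+
  ultimately show ?thesis by blast
qed

end

section \<open>Inner faces of the labelled cycle\<close>

context outerplanar_labelling
begin

text \<open>
  The vertices \<open>p 0, \<dots>, p (t - 1)\<close> bound an inner face, continued to a sequence with
  \<open>p (k + t) = p k + n\<close>.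
\<close>

definition face :: "(nat \<Rightarrow> int) \<Rightarrow> nat \<Rightarrow> bool" where
  "face p t \<longleftrightarrow> 3 \<le> t \<and> strict_mono p \<and> (\<forall>k. p (k + t) = p k + n) \<and> (\<forall>k. Q (p k) (p (k + 1))) \<and>
    (\<forall>k l. k + 2 \<le> l \<longrightarrow> l + 2 \<le> k + t \<longrightarrow> \<not> Q (p k) (p l))"

text \<open>If a side from \<open>a\<close> to \<open>b\<close> spanned three or more, claws at
  \<open>a\<close> and at \<open>b\<close> would force the chords from \<open>a + 1\<close> to
  \<open>b\<close> and from \<open>a\<close> to \<open>b - 1\<close>, which cross. The extra
  assumption covers triangles, where the corner before \<open>a\<close> is itself adjacent to
  \<open>b\<close> and therefore must not be \<open>a - 1\<close>.\<close>

lemma face_gap: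
  assumes f: "face p t" and t: "t = 3 \<Longrightarrow> \<forall>k. p k + 2 \<le> p (k + 1)"
  shows "p (k + 1) \<le> p k + 2"
proof -
  have t3: "3 \<le> t" and mono: "strict_mono p" and per: "\<And>k. p (k + t) = p k + n"
    and edge: "\<And>k. Q (p k) (p (k + 1))"
    and chordless: "\<And>k l. k + 2 \<le> l \<Longrightarrow> l + 2 \<le> k + t \<Longrightarrow> \<not> Q (p k) (p l)"
    using f by (auto simp: face_def)
  have gap: "p (k + 2) \<le> p (k + 1) + 2" for k
  proof (rule ccontr)
    define a' a b b' where ab: "a' = p k" "a = p (k + 1)" "b = p (k + 2)" "b' = p (k + 3)"
    assume "\<not> ?thesis"
    then have ab3: "a + 3 \<le> b" by (simp add: ab)
    have lt: "a' < a" "b < b'" using strict_monoD[OF mono] by (auto simp: ab)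
    have "p (k + 3) \<le> p (k + t)" using t3 mono by (simp add: strict_mono_less_eq)
    then have le: "b' \<le> a' + n" using per by (simp add: ab)
    have e: "Q a' a" "Q a b" "Q b b'"
      using edge[of k] edge[of "k + 1"] edge[of "k + 2"] by (auto simp: ab eval_nat_numeral)
    have e': "Q a (a - 1)" "Q a (a + 1)" "Q b (b - 1)" "Q b (b + 1)" "Q b a"
      using cycle_edge[of a] cycle_edge[of "a - 1"] cycle_edge[of b] cycle_edge[of "b - 1"] Q_comm e(2)
      by auto
    have tt: "t = 3 \<Longrightarrow> a' + 2 \<le> a \<and> b + 2 \<le> b'"
      using t by (auto simp: ab eval_nat_numeral)
    have "\<not> Q (a - 1) b"
    proof (cases "a' = a - 1")
      case True
      with tt t3 have "4 \<le> t" by (cases "t = 3") auto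
      then show ?thesis using chordless[of k "k + 2"] True by (auto simp: ab)
    next
      case False
      then show ?thesis using noncrossing[of a' "a - 1" a b] lt le ab3 e(1) by auto
    qed
    moreover have "\<not> Q (a - 1) (a + 1)"
      using noncrossing[of "a - 1" a "a + 1" b] lt le ab3 e(2) by auto
    ultimately have 1: "Q (a + 1) b"
      using claw_cyclic[of "a - 1" "a + 1" b a] lt le ab3 e(2) e' by auto
    have "\<not> Q a (b + 1)"
    proof (cases "b' = b + 1")
      case True
      with tt t3 have "4 \<le> t" by (cases "t = 3") auto
      then show ?thesis using chordless[of "k + 1" "k + 3"] True by (auto simp: ab)
    next
      case False
      then show ?thesis using noncrossing[of a b "b + 1" b'] lt le ab3 e(3) by auto
    qed
    moreover have "\<not> Q (b - 1) (b + 1)"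
      using noncrossing[of a "b - 1" b "b + 1"] lt le ab3 e(2) by auto
    ultimately have "Q a (b - 1)"
      using claw_cyclic[of a "b - 1" "b + 1" b] lt le ab3 e' by auto
    then show False using noncrossing[of a "a + 1" "b - 1" b] 1 lt le ab3 by auto
  qed
  \<comment> \<open>\<open>gap\<close> refers to the corner before the side, which natural indices
    do not provide at 0; one full turn later it exists.\<close>
  have "p (k + 1) - p k = p (k + t - 1 + 2) - p (k + t - 1 + 1)"
    using per[of k] per[of "k + 1"] t3 by (auto simp: algebra_simps)
  then show ?thesis using gap[of "k + t - 1"] by linarith
qed

text \<open>A shortest increasing walk from \<open>i\<close> to \<open>j\<close> with at least three
  vertices bounds a face together with the edge from \<open>j\<close> back to \<open>i\<close>.
  Exactly three vertices would be a triangle excluded by \<open>no\<close>.\<close>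

lemma untriangulated_imp_face:
  assumes ij: "i + 2 \<le> j" "j < i + n" "Q i j"
    and no: "\<And>k. i < k \<Longrightarrow> k < j \<Longrightarrow> Q i k \<Longrightarrow> Q k j \<Longrightarrow> False"
  shows "\<exists>p t. 4 \<le> t \<and> face p t"
proof -
  let ?r = "\<lambda>x y. x < y \<and> Q x y"
  \<comment> \<open>The lower bound on the length rules out the walk that consists of the edge from
    \<open>i\<close> to \<open>j\<close> alone.\<close>
  let ?P = "\<lambda>ps. 3 \<le> length ps \<and> hd ps = i \<and> last ps = j \<and> successively ?r ps"
  have "?P [i..j]"
    using ij cycle_edge by (auto simp: hd_conv_nth last_conv_nth upto_Nil2 intro!: successively_upto)
  then obtain ps where ps: "?P ps" and min: "\<And>qs. ?P qs \<Longrightarrow> length ps \<le> length qs"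
    using ex_has_least_nat[of ?P "[i..j]" length] by blast
  define t where "t = length ps"
  have ne: "ps \<noteq> []" using ps by auto
  then have i: "ps ! 0 = i" and j: "ps ! (t - 1) = j"
    using ps by (auto simp: t_def hd_conv_nth last_conv_nth)
  have step: "ps ! k < ps ! Suc k" "Q (ps ! k) (ps ! Suc k)" if "Suc k < t" for k
    using ps that by (auto simp: t_def successively_conv_nth)
  have t4: "4 \<le> t"
  proof (rule ccontr)
    assume "\<not> ?thesis"
    then have "t = 3" using ps by (simp add: t_def)
    then show False using step[of 0] step[of 1] no[of "ps ! 1"] i j by (auto simp: eval_nat_numeral)
  qed
  \<comment> \<open>A chord is a shortcut; \<open>b + 2 \<le> a + t\<close> says precisely that the
    shortened walk keeps three vertices.\<close>
  have short: "\<not> Q (ps ! a) (ps ! b)" if "a + 2 \<le> b" "b < t" "b + 2 \<le> a + t" for a b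
  proof
    assume q: "Q (ps ! a) (ps ! b)"
    let ?qs = "take (Suc a) ps @ drop b ps"
    have "successively (<) ps" using ps by (auto elim: successively_mono)
    then have sw: "sorted_wrt (<) ps" using successively_conv_sorted_wrt[of "(<)" ps] by simp
    have "successively ?r (take (Suc a) ps @ drop (Suc a) ps)" "successively ?r (take b ps @ drop b ps)"
      using ps by simp_all
    then have "successively ?r (take (Suc a) ps)" "successively ?r (drop b ps)"
      unfolding successively_append_iff by blast+
    moreover have "last (take (Suc a) ps) = ps ! a" "hd (drop b ps) = ps ! b"
      using that by (auto simp: t_def take_Suc_conv_app_nth hd_drop_conv_nth)
    moreover have "ps ! a < ps ! b"
      using sw that by (auto simp: t_def sorted_wrt_iff_nth_less)
    ultimately have "successively ?r ?qs" using q by (auto simp: successively_append_iff)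
    moreover have "hd ?qs = i" "last ?qs = j" "3 \<le> length ?qs"
      using ps ne that by (auto simp: t_def)
    ultimately have "length ps \<le> length ?qs" using min by blast
    then show False using that by (auto simp: t_def)
  qed
  \<comment> \<open>The corners are repeated forever, raised by \<open>n\<close> at each
    turn.\<close>
  define p where "p k = ps ! (k mod t) + n * int (k div t)" for k
  have cp: "c (p k) = c (ps ! (k mod t))" for k by (simp add: p_def c_period_nat)
  have "p k < p (Suc k) \<and> Q (p k) (p (Suc k))" for k
  proof (cases "Suc (k mod t) < t")
    case True
    then have "Suc k mod t = Suc (k mod t)" "Suc k div t = k div t"
      by (auto simp: mod_Suc div_Suc)
    then show ?thesis using step[OF True] unfolding cp by (simp add: p_def)
  next
    case False
    then have k: "Suc (k mod t) = t" using t4 by (metis Suc_lessI mod_less_divisor less_le_trans zero_less_numeral)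
    then have "Suc k mod t = 0" "Suc k div t = Suc (k div t)" "k mod t = t - 1"
      by (auto simp: mod_Suc div_Suc)
    then show ?thesis using ij i j Q_comm unfolding cp by (simp add: p_def algebra_simps)
  qed
  moreover have "p (k + t) = p k + n" for k
    using t4 by (simp add: p_def algebra_simps div_add_self2)
  moreover have "\<not> Q (p k) (p l)" if kl: "k + 2 \<le> l" "l + 2 \<le> k + t" for k l
  proof -
    define a q where aq: "a = k mod t" "q = k div t"
    have a: "a < t" "k = q * t + a" using t4 by (auto simp: aq)
    show ?thesis
    \<comment> \<open>Either \<open>l\<close> lies in the same turn as \<open>k\<close>, or in the
      next one, where the residues appear in the opposite order.\<close>
    proof (cases "a + (l - k) < t")
      case True
      define b where "b = a + (l - k)"
      have "l = q * t + b" "b < t" using True kl a by (auto simp: b_def)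
      then have "l mod t = b" by simp
      moreover have "a + 2 \<le> b" "b + 2 \<le> a + t" using kl by (auto simp: b_def)
      ultimately show ?thesis
        unfolding cp aq(1)[symmetric] using short[of a b] \<open>b < t\<close> by simp
    next
      case False
      define b where "b = a + (l - k) - t"
      have "l = Suc q * t + b" "b < t" using False kl a by (auto simp: b_def)
      then have "l mod t = b" by (metis mod_less mod_mult_self3)
      moreover have "b + 2 \<le> a" "a + 2 \<le> b + t" using kl False by (auto simp: b_def)
      ultimately show ?thesis
        unfolding cp aq(1)[symmetric] using short[of b a] a(1) Q_comm by simp
    qed
  qed
  ultimately have "face p t"
    using t4 by (auto simp: face_def strict_mono_Suc_iff)
  then show ?thesis using t4 by blast
qed

text \<open>For three corners the chordlessness condition of \<open>face\<close> is vacuous, and the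
  assumptions make every side, also the one from \<open>j\<close> to \<open>i + n\<close>, span at
  least two.\<close>

lemma inner_triangle_imp_face:
  assumes "i + 2 \<le> k" "k + 2 \<le> j" "j + 2 \<le> i + n" "Q i k" "Q k j" "Q i j"
  shows "\<exists>p. face p 3 \<and> (\<forall>k. p k + 2 \<le> p (k + 1))"
proof -
  define p where "p m = [i, k, j] ! (m mod 3) + n * int (m div 3)" for m
  have cp: "c (p m) = c ([i, k, j] ! (m mod 3))" for m by (simp add: p_def c_period_nat)
  have step: "p m + 2 \<le> p (Suc m) \<and> Q (p m) (p (Suc m))" for m
  proof -
    have "m mod 3 < 3" by simp
    then consider "m mod 3 = 0" | "m mod 3 = 1" | "m mod 3 = 2" by linarith
    then show ?thesis
      by cases (use assms Q_comm in \<open>unfold cp, auto simp: p_def mod_Suc div_Suc algebra_simps\<close>)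
  qed
  have "p m < p (Suc m)" for m using step[of m] by linarith
  then have "strict_mono p" by (simp add: strict_mono_Suc_iff)
  moreover have "p (m + 3) = p m + n" for m
    by (simp add: p_def algebra_simps div_add_self2)
  ultimately show ?thesis using step by (intro exI[of _ p]) (auto simp: face_def)
qed

end

section \<open>Isomorphisms with zigzag graphs and with the graphs of a cycle with attached
  triangles\<close>

text \<open>The map runs from the model \<open>H\<close> to \<open>G\<close>, the direction in which
  labellings are given.\<close>

lemma digraph_iso_pairI:
  assumes GH: "pair_graph G" "pair_graph H" and g: "bij_betw g (pverts H) (pverts G)"
    and adj: "\<And>x y. x \<in> pverts H \<Longrightarrow> y \<in> pverts H \<Longrightarrow>
      (x, y) \<in> parcs H \<longleftrightarrow> (g x, g y) \<in> parcs G"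
  shows "digraph_iso (with_proj G) (with_proj H)"
proof -
  let ?f = "inv_into (pverts H) g"
  have "bij_betw ?f (pverts G) (pverts H)" using g by (rule bij_betw_inv_into)
  moreover have "(u, v) \<in> parcs G \<longleftrightarrow> (?f u, ?f v) \<in> parcs H"
    if "u \<in> pverts G" "v \<in> pverts G" for u v
    using adj[of "?f u" "?f v"] that g bij_betw_inv_into_right[OF g]
      bij_betwE[OF bij_betw_inv_into[OF g]] by auto
  ultimately show ?thesis unfolding digraph_iso_pair_iff[OF GH] by blast
qed

lemma digraph_iso_pairI_linorder:
  fixes H :: "'b::linorder pair_pre_digraph"
  assumes GH: "pair_graph G" "pair_graph H" and g: "bij_betw g (pverts H) (pverts G)"
    and adj: "\<And>x y. x \<in> pverts H \<Longrightarrow> y \<in> pverts H \<Longrightarrow> x < y \<Longrightarrow>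
      (x, y) \<in> parcs H \<longleftrightarrow> (g x, g y) \<in> parcs G"
  shows "digraph_iso (with_proj G) (with_proj H)"
proof (rule digraph_iso_pairI[OF GH g])
  interpret G: pair_graph G by fact
  interpret H: pair_graph H by fact
  fix x y assume xy: "x \<in> pverts H" "y \<in> pverts H"
  consider "x < y" | "x = y" | "y < x" by fastforce
  then show "(x, y) \<in> parcs H \<longleftrightarrow> (g x, g y) \<in> parcs G"
  proof cases
    case 2
    then show ?thesis using G.no_loops' H.no_loops' by blast
  next
    case 3
    have "(u, v) \<in> parcs G \<longleftrightarrow> (v, u) \<in> parcs G" "(a, b) \<in> parcs H \<longleftrightarrow> (b, a) \<in> parcs H" for u v a b
      using G.graph_symmetric H.graph_symmetric by auto
    then show ?thesis using adj[OF xy(2,1) 3] by blast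
  qed (use adj xy in blast)
qed

lemma pverts_graph_Z: "pverts (graph_Z d) = {0..2 * d}"
  by (simp add: graph_Z_def graph_L_def)

lemma graph_Z_arc_iff:
  assumes "x < y"
  shows "(x, y) \<in> parcs (graph_Z d) \<longleftrightarrow> y \<le> 2 * d \<and> (y = x + 1 \<or> x + y = 2 * d \<or> x + y + 1 = 2 * d)"
proof -
  have "(x, y) \<in> parcs (graph_Z d) \<longleftrightarrow>
      y = x + 1 \<and> x < 2 * d \<or> y = 2 * d - x \<and> x < d \<or> y = 2 * d - 1 - x \<and> x + 2 \<le> d"
    using assms by (auto simp: graph_Z_def graph_L_def symcl_def)
  also have "\<dots> \<longleftrightarrow> y = x + 1 \<and> y \<le> 2 * d \<or> x + y = 2 * d \<or> x + y + 1 = 2 * d \<and> x + 2 \<le> d"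
    using assms by (intro disj_cong refl) linarith+
  also have "\<dots> \<longleftrightarrow> y \<le> 2 * d \<and> (y = x + 1 \<or> x + y = 2 * d \<or> x + y + 1 = 2 * d)"
    using assms by linarith
  finally show ?thesis .
qed

lemma graph_Zstar_with_proj:
  "graph_Zstar d = with_proj \<lparr>pverts = {0..2 * d} - {d},
     parcs = {(x, y) \<in> parcs (graph_Z d). x \<noteq> d \<and> y \<noteq> d}\<rparr>"
  by (auto simp: graph_Zstar_def pre_digraph.del_vert_def with_proj_def graph_Z_def graph_L_def)

lemma pair_graph_Zstar:
  "pair_graph \<lparr>pverts = {0..2 * d} - {d}, parcs = {(x, y) \<in> parcs (graph_Z d). x \<noteq> d \<and> y \<noteq> d}\<rparr>"
proof -
  interpret Z: pair_graph "graph_Z d" by (rule pair_graph_Z)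
  show ?thesis
  proof
    show "finite (parcs \<lparr>pverts = {0..2 * d} - {d}, parcs = {(x, y) \<in> parcs (graph_Z d). x \<noteq> d \<and> y \<noteq> d}\<rparr>)"
      by (rule finite_subset[of _ "{0..2 * d} \<times> {0..2 * d}"])
        (use Z.wellformed' pverts_graph_Z[of d] in auto)
    show "symmetric (with_proj \<lparr>pverts = {0..2 * d} - {d}, parcs = {(x, y) \<in> parcs (graph_Z d). x \<noteq> d \<and> y \<noteq> d}\<rparr>)"
      using Z.graph_symmetric by (auto simp: symmetric_def sym_def)
  qed (use Z.wellformed' Z.no_loops' pverts_graph_Z in auto)
qed

text \<open>For \<open>n = 2 * d + 1\<close> the labels are those of \<open>graph_Z d\<close>. For
  \<open>n = 2 * d\<close> the middle vertex \<open>d\<close> is missing and the labels above it are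
  one too large.\<close>

lemma zigzag_iso:
  fixes b :: "int \<Rightarrow> 'a"
  assumes G: "pair_graph G" and n: "3 \<le> n" and b: "bij_betw b {0..<n} (pverts G)"
    and adj: "\<And>i j. \<lbrakk>0 \<le> i; i < j; j < n\<rbrakk> \<Longrightarrow>
      (b i, b j) \<in> parcs G \<longleftrightarrow> j = i + 1 \<or> i + j = n - 1 \<or> i + j = n - 2"
  shows "\<exists>d\<ge>1. digraph_iso (with_proj G) (with_proj (graph_Z d)) \<or>
    digraph_iso (with_proj G) (graph_Zstar d)"
proof (cases "even n")
  case False
  then obtain m where "n = 2 * m + 1" by (elim oddE)
  then obtain d where d: "n = 2 * int d + 1" using n nonneg_int_cases[of m] by auto
  have "bij_betw int (pverts (graph_Z d)) {0..<n}"
    by (rule bij_betw_byWitness[where f' = nat]) (auto simp: d pverts_graph_Z)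
  then have "bij_betw (b \<circ> int) (pverts (graph_Z d)) (pverts G)"
    using b by (rule bij_betw_trans)
  then have "digraph_iso (with_proj G) (with_proj (graph_Z d))"
  proof (rule digraph_iso_pairI_linorder[OF G pair_graph_Z])
    fix x y assume "x \<in> pverts (graph_Z d)" "y \<in> pverts (graph_Z d)" "x < y"
    then show "(x, y) \<in> parcs (graph_Z d) \<longleftrightarrow> ((b \<circ> int) x, (b \<circ> int) y) \<in> parcs G"
      using adj[of "int x" "int y"] by (auto simp: graph_Z_arc_iff d pverts_graph_Z)
  qed
  then show ?thesis using n d by (intro exI[of _ d]) auto
next
  case True
  then obtain m where "n = 2 * m" by (elim evenE)
  then obtain d where d: "n = 2 * int d" using n nonneg_int_cases[of m] by auto
  \<comment> \<open>This makes \<open>d - 1\<close> and \<open>d + 1\<close> consecutive; they are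
    adjacent in \<open>graph_Z d\<close> as a pair of sum \<open>2 * d\<close>.\<close>
  let ?f = "\<lambda>x. if x < d then int x else int x - 1"
  let ?H = "\<lparr>pverts = {0..2 * d} - {d}, parcs = {(x, y) \<in> parcs (graph_Z d). x \<noteq> d \<and> y \<noteq> d}\<rparr>"
  have "bij_betw ?f (pverts ?H) {0..<n}"
    by (rule bij_betw_byWitness[where f' = "\<lambda>i. if i < int d then nat i else nat (i + 1)"])
      (auto simp: d)
  then have "bij_betw (b \<circ> ?f) (pverts ?H) (pverts G)"
    using b by (rule bij_betw_trans)
  then have "digraph_iso (with_proj G) (with_proj ?H)"
  proof (rule digraph_iso_pairI_linorder[OF G pair_graph_Zstar])
    fix x y assume xy: "x \<in> pverts ?H" "y \<in> pverts ?H" "x < y"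
    then have "((b \<circ> ?f) x, (b \<circ> ?f) y) \<in> parcs G \<longleftrightarrow>
        ?f y = ?f x + 1 \<or> ?f x + ?f y = n - 1 \<or> ?f x + ?f y = n - 2"
      unfolding o_def by (intro adj) (auto simp: d)
    also have "\<dots> \<longleftrightarrow> (x, y) \<in> parcs ?H"
      using xy by (auto simp: graph_Z_arc_iff d)
    finally show "(x, y) \<in> parcs ?H \<longleftrightarrow> ((b \<circ> ?f) x, (b \<circ> ?f) y) \<in> parcs G" by blast
  qed
  then show ?thesis using n d by (intro exI[of _ d]) (auto simp: graph_Zstar_with_proj)
qed

lemma sun_graph_arc_iff:
  "(Inl a, Inl b) \<in> parcs (sun_graph t I) \<longleftrightarrow>
    a < t \<and> b = (a + 1) mod t \<or> b < t \<and> a = (b + 1) mod t"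
  "(Inr k, Inl b) \<in> parcs (sun_graph t I) \<longleftrightarrow> k \<in> I \<and> (b = k \<or> b = (k + 1) mod t)"
  "(Inl b, Inr k) \<in> parcs (sun_graph t I) \<longleftrightarrow> k \<in> I \<and> (b = k \<or> b = (k + 1) mod t)"
  "(Inr k, Inr l) \<notin> parcs (sun_graph t I)"
  by (auto simp: sun_graph_def symcl_def)

context outerplanar_labelling
begin

text \<open>By \<open>face_gap\<close> every side spans one or two. The corners form the cycle, and
  the vertex behind a side of span two is the additional vertex of that side: an edge from it to
  anything but the ends of the side would cross the side.\<close>

lemma sun_iso:
  assumes G: "pair_graph G" "pverts G = range c" "\<And>u v. E u v \<longleftrightarrow> (u, v) \<in> parcs G"
    and f: "face p t" and full: "t = 3 \<Longrightarrow> \<forall>k. p k + 2 \<le> p (k + 1)"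
  shows "\<exists>H \<in> graphs_S t. digraph_iso (with_proj G) (with_proj H)"
proof -
  have t3: "3 \<le> t" and mono: "strict_mono p" and per: "\<And>k. p (k + t) = p k + n"
    and edge: "\<And>k. Q (p k) (p (k + 1))"
    and chordless: "\<And>k l. k + 2 \<le> l \<Longrightarrow> l + 2 \<le> k + t \<Longrightarrow> \<not> Q (p k) (p l)"
    using f by (auto simp: face_def)
  define I where "I = {k. k < t \<and> p (k + 1) = p k + 2}"
  let ?H = "sun_graph t I"
  have H: "?H \<in> graphs_S t" by (auto simp: graphs_S_def I_def)
  have pt: "p t = p 0 + n" using per[of 0] by simp
  have less: "p k < p l \<longleftrightarrow> k < l" and le: "p k \<le> p l \<longleftrightarrow> k \<le> l" for k l
    using mono by (auto simp: strict_mono_less strict_mono_less_eq)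
  have p_inj: "p k = p l \<longleftrightarrow> k = l" for k l
    using mono by (auto simp: strict_mono_eq)
  have p_off: "p k + 1 \<noteq> p l" if "k \<in> I" for k l
    using less[of k l] le[of "k + 1" l] that by (auto simp: I_def)
  have c_mod: "c (p ((k + 1) mod t)) = c (p (k + 1))" if "k < t" for k
    using that pt c_period[of "p 0"] by (cases "k + 1 = t") auto
  define h where "h = case_sum p (\<lambda>k. p k + 1)"
  have "bij_betw h (pverts ?H) {p 0..<p 0 + n}"
  proof (rule bij_betw_imageI)
    show "inj_on h (pverts ?H)"
      by (auto simp: inj_on_def h_def sun_graph_def p_inj p_off dest: sym)
    show "h ` pverts ?H = {p 0..<p 0 + n}"
    proof (intro equalityI subsetI)
      fix z assume "z \<in> h ` pverts ?H"
      then consider k where "k < t" "z = p k" | k where "k \<in> I" "z = p k + 1"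
        by (auto simp: h_def sun_graph_def)
      then show "z \<in> {p 0..<p 0 + n}"
      proof cases
        case 1
        then show ?thesis using le[of 0 k] less[of k t] pt by auto
      next
        case 2
        then show ?thesis using le[of 0 k] le[of "k + 1" t] pt by (auto simp: I_def)
      qed
    next
      fix z assume z: "z \<in> {p 0..<p 0 + n}"
      \<comment> \<open>Locates \<open>z\<close> on the side that starts at the last corner not
        beyond it.\<close>
      have *: "\<exists>k<s. p k \<le> z \<and> z < p (k + 1)" if "z < p s" for s
        using that
      proof (induction s)
        case 0
        then show ?case using z by simp
      next
        case (Suc s)
        then show ?case by (cases "z < p s") (auto simp: less_Suc_eq)
      qed
      obtain k where k: "k < t" "p k \<le> z" "z < p (k + 1)" using *[of t] z pt by auto
      then have "z = p k \<or> k \<in> I \<and> z = p k + 1"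
        using face_gap[OF f full, of k] by (auto simp: I_def)
      then show "z \<in> h ` pverts ?H"
      proof
        assume "z = p k"
        then show ?thesis using k by (intro image_eqI[of _ _ "Inl k"]) (auto simp: h_def sun_graph_def)
      next
        assume "k \<in> I \<and> z = p k + 1"
        then show ?thesis by (intro image_eqI[of _ _ "Inr k"]) (auto simp: h_def sun_graph_def)
      qed
    qed
  qed
  then have bij: "bij_betw (c \<circ> h) (pverts ?H) (pverts G)"
    using bij_betw_trans[OF _ bij_betw_window] G(2) by simp
  have ll: "Q (p a) (p b) \<longleftrightarrow> b = (a + 1) mod t \<or> a = (b + 1) mod t" if "a < b" "b < t" for a b
  proof -
    have "Q (p (t - 1)) (p 0)"
      using edge[of "t - 1"] t3 pt c_period[of "p 0"] by simp
    then have "Q (p a) (p b)" if "a = 0" "b = t - 1" using that Q_comm by blast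
    moreover have "b = a + 1 \<or> a = 0 \<and> b = t - 1" if "Q (p a) (p b)"
      using chordless[of a b] that \<open>a < b\<close> \<open>b < t\<close> by force
    moreover have "b = (a + 1) mod t \<longleftrightarrow> b = a + 1" using that by (auto simp: mod_Suc)
    moreover have "a = (b + 1) mod t \<longleftrightarrow> a = 0 \<and> b = t - 1" using that by (auto simp: mod_Suc)
    ultimately show ?thesis using edge[of a] by auto
  qed
  have far: "\<not> Q (p k + 1) z" if "k \<in> I" "p k + 2 < z" "z < p k + n" for k z
    using noncrossing[of "p k" "p k + 1" "p k + 2" z] edge[of k] that by (auto simp: I_def)
  have rl: "Q (p k + 1) (p b) \<longleftrightarrow> b = k \<or> b = (k + 1) mod t" if k: "k \<in> I" and b: "b < t" for k b
  proof
    assume q: "Q (p k + 1) (p b)"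
    have kt: "k < t" "p (k + 1) = p k + 2" using k by (auto simp: I_def)
    consider "b = k" | "b = k + 1" | "k + 1 < b" | "b < k" "0 < b \<or> k + 1 < t" | "b = 0" "k + 1 = t"
      using kt b by linarith
    then show "b = k \<or> b = (k + 1) mod t"
    proof cases
      case 3
      then have "p (k + 1) < p b" "p b < p t" "p 0 \<le> p k" using b by (auto simp: less le)
      then show ?thesis using far[of k "p b"] k q pt kt by auto
    next
      \<comment> \<open>The corner \<open>p b\<close> precedes the side, so it is replaced by its
        copy one period later to apply \<open>far\<close>.\<close>
      case 4
      then have "p (k + 1) \<le> p t" "p 0 \<le> p b" "p b < p k" "p (k + 1) < p t \<or> p 0 < p b"
        using kt(1) unfolding less le by auto
      then show ?thesis using far[of k "p b + n"] k q pt kt c_period[of "p b"] by auto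
    qed (use b in auto)
  next
    have "Q (p k + 1) (p (k + 1))" using k cycle_edge[of "p k + 1"] by (simp add: I_def add.commute)
    moreover have "Q (p k + 1) (p k)" using cycle_edge[of "p k"] Q_comm by blast
    moreover assume "b = k \<or> b = (k + 1) mod t"
    ultimately show "Q (p k + 1) (p b)" using k c_mod[of k] by (auto simp: I_def)
  qed
  have rr: "\<not> Q (p k + 1) (p l + 1)" if "k \<in> I" "l \<in> I" "k < l" for k l
  proof -
    have "p (k + 1) \<le> p l" "p (l + 1) \<le> p t" "p 0 \<le> p k" using that unfolding le by (auto simp: I_def)
    then show ?thesis using far[of k "p l + 1"] that pt by (auto simp: I_def)
  qed
  have "digraph_iso (with_proj G) (with_proj ?H)"
  proof (rule digraph_iso_pairI[OF G(1) pair_graph_S[OF t3 H] bij])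
    fix x y assume "x \<in> pverts ?H" "y \<in> pverts ?H"
    then consider a b where "x = Inl a" "y = Inl b" "a < t" "b < t"
      | k b where "x = Inr k" "y = Inl b" "k \<in> I" "b < t"
      | k b where "x = Inl b" "y = Inr k" "k \<in> I" "b < t"
      | k l where "x = Inr k" "y = Inr l" "k \<in> I" "l \<in> I"
      by (auto simp: sun_graph_def)
    then have "(x, y) \<in> parcs ?H \<longleftrightarrow> E (c (h x)) (c (h y))"
    proof cases
      case 1
      consider "a < b" | "b < a" | "a = b" by linarith
      then show ?thesis
      proof cases
        case 3
        then show ?thesis using 1 t3 irrefl_E by (auto simp: sun_graph_arc_iff h_def mod_Suc)
      qed (use 1 ll[of a b] ll[of b a] Q_comm[of "p a" "p b"] in
            \<open>auto simp: sun_graph_arc_iff h_def\<close>)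
    next
      case 2
      then show ?thesis using rl[of k b] by (auto simp: sun_graph_arc_iff h_def)
    next
      case 3
      then show ?thesis
        using rl[of k b] Q_comm[of "p k + 1" "p b"] by (auto simp: sun_graph_arc_iff h_def)
    next
      case 4
      consider "k < l" | "l < k" | "k = l" by linarith
      then have "\<not> Q (p k + 1) (p l + 1)"
        by cases (use rr[of k l] rr[of l k] 4 Q_comm[of "p k + 1" "p l + 1"] irrefl_E in auto)
      then show ?thesis using 4 by (simp add: sun_graph_arc_iff h_def)
    qed
    then show "(x, y) \<in> parcs ?H \<longleftrightarrow> ((c \<circ> h) x, (c \<circ> h) y) \<in> parcs G" by (simp add: G(3))
  qed
  with H show ?thesis by blast
qed

lemma zigzag_or_sun:
  assumes G: "pair_graph G" "pverts G = range c" "\<And>u v. E u v \<longleftrightarrow> (u, v) \<in> parcs G"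
  shows "(\<exists>d\<ge>1. digraph_iso (with_proj G) (with_proj (graph_Z d)) \<or>
      digraph_iso (with_proj G) (graph_Zstar d)) \<or>
    (\<exists>t\<ge>3. \<exists>H \<in> graphs_S t. digraph_iso (with_proj G) (with_proj H))"
proof (cases "\<exists>p t. face p t \<and> (t = 3 \<longrightarrow> (\<forall>k. p k + 2 \<le> p (k + 1)))")
  case True
  then obtain p t where pt: "face p t" "t = 3 \<longrightarrow> (\<forall>k. p k + 2 \<le> p (k + 1))" by blast
  then have "3 \<le> t" by (simp add: face_def)
  then show ?thesis using sun_iso[OF G pt(1)] pt(2) by blast
next
  case no_face: False
  have "\<exists>b. bij_betw b {0..<n} (range c) \<and> (\<forall>i j. 0 \<le> i \<longrightarrow> i < j \<longrightarrow> j < n \<longrightarrow>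
    (E (b i) (b j) \<longleftrightarrow> j = i + 1 \<or> i + j = n - 1 \<or> i + j = n - 2))"
  proof (rule triangulated_imp_zigzag)
    fix i j assume ij: "i + 2 \<le> j" "j < i + n" "Q i j"
    show "\<exists>k. i < k \<and> k < j \<and> Q i k \<and> Q k j"
    proof (rule ccontr)
      assume "\<not> ?thesis"
      then obtain p t where "4 \<le> t" "face p t"
        using untriangulated_imp_face[OF ij] by blast
      moreover from this no_face have "t = 3" by blast
      ultimately show False by simp
    qed
  next
    fix i k j assume "i + 2 \<le> k" "k + 2 \<le> j" "j + 2 \<le> i + n" "Q i k" "Q k j" "Q i j"
    from inner_triangle_imp_face[OF this] no_face show False by blast
  qed
  then obtain b where "bij_betw b {0..<n} (pverts G)" "\<And>i j. \<lbrakk>0 \<le> i; i < j; j < n\<rbrakk> \<Longrightarrow>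
      (b i, b j) \<in> parcs G \<longleftrightarrow> j = i + 1 \<or> i + j = n - 1 \<or> i + j = n - 2"
    using G(2,3) by auto
  then show ?thesis using zigzag_iso[OF G(1) n3] by blast
qed

end

section \<open>Straight-line drawings in convex position\<close>

text \<open>
  Vertices in convex position: on the parabola \<open>y = x\<^sup>2\<close>, the chord from \<open>a\<close> to \<open>b\<close> lies above
  the parabola by \<open>(x - a) (b - x)\<close>.
\<close>

definition parabola :: "int \<Rightarrow> complex" where
  "parabola i = Complex (of_int i) ((of_int i)\<^sup>2)"

lemma parabola_eq_iff: "parabola i = parabola j \<longleftrightarrow> i = j"
  by (auto simp: parabola_def)

lemma parabola_chord:
  assumes "z \<in> closed_segment (parabola i) (parabola j)" "i \<le> j"
  shows "of_int i \<le> Re z" "Re z \<le> of_int j"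
    "Im z = (Re z)\<^sup>2 + (Re z - of_int i) * (of_int j - Re z)"
proof -
  obtain u where u: "0 \<le> u" "u \<le> 1" "z = (1 - u) *\<^sub>R parabola i + u *\<^sub>R parabola j"
    using assms(1) by (auto simp: closed_segment_def)
  have re: "Re z = of_int i + u * (of_int j - of_int i)"
    by (simp add: u(3) parabola_def algebra_simps)
  have im: "Im z = (1 - u) * (of_int i)\<^sup>2 + u * (of_int j)\<^sup>2"
    by (simp add: u(3) parabola_def)
  show "of_int i \<le> Re z" unfolding re using u(1) assms(2) by simp
  have "u * (of_int j - of_int i :: real) \<le> of_int j - of_int i"
    using u assms(2) by (intro mult_left_le_one_le) auto
  then show "Re z \<le> of_int j" unfolding re by simp
  show "Im z = (Re z)\<^sup>2 + (Re z - of_int i) * (of_int j - Re z)"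
    unfolding re im by (simp add: power2_eq_square algebra_simps)
qed

lemma complex_eq_parabola:
  assumes "Re z = of_int i" "Im z = (Re z)\<^sup>2"
  shows "z = parabola i"
  using assms by (simp add: parabola_def complex_eq_iff)

lemma parabola_chord_vertex:
  assumes "parabola k \<in> closed_segment (parabola i) (parabola j)" "i < j"
  shows "k = i \<or> k = j"
  using parabola_chord(3)[OF assms(1)] assms(2) by (auto simp: parabola_def)

text \<open>At a common point both chords have the same height above the parabola. If the point is
  inner to the first chord, this height is positive, so it is inner to both; without crossing, one
  interval then properly contains the other and its chord is strictly higher.\<close>

lemma parabola_chords_inter:
  assumes z: "z \<in> closed_segment (parabola i) (parabola j)" "z \<in> closed_segment (parabola k) (parabola l)"
    and lt: "i < j" "k < l" and neq: "(i, j) \<noteq> (k, l)"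
    and nc: "\<not> (i < k \<and> k < j \<and> j < l)" "\<not> (k < i \<and> i < l \<and> l < j)"
  shows "z = parabola i \<or> z = parabola j"
proof -
  define x where "x = Re z"
  have *: "of_int i \<le> x" "x \<le> of_int j" "of_int k \<le> x" "x \<le> of_int l"
    "Im z = x\<^sup>2 + (x - of_int i) * (of_int j - x)" "Im z = x\<^sup>2 + (x - of_int k) * (of_int l - x)"
    using parabola_chord[OF z(1)] parabola_chord[OF z(2)] lt by (auto simp: x_def)
  have eq: "(x - of_int i) * (of_int j - x) = (x - of_int k) * (of_int l - x)"
    using * by simp
  show ?thesis
  proof (cases "x = of_int i \<or> x = of_int j")
    case True
    then show ?thesis using * complex_eq_parabola[of z] by (auto simp: x_def)
  next
    case False
    then have "0 < (x - of_int i) * (of_int j - x)" using * by simp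
    then have "x \<noteq> of_int k" "x \<noteq> of_int l" unfolding eq by auto
    then have lts: "of_int i < x" "x < of_int j" "of_int k < x" "x < of_int l"
      using * False by auto
    then have "real_of_int i < of_int l" "real_of_int k < of_int j" by linarith+
    then have "i < l" "k < j" by auto
    then have "i \<le> k \<and> l \<le> j \<or> k \<le> i \<and> j \<le> l" using nc by linarith
    moreover have False if "i \<le> k" "l \<le> j"
    proof -
      have "(x - of_int k) * (of_int l - x) < (x - of_int i) * (of_int j - x)"
      proof (cases "i = k")
        case True
        then show ?thesis using that neq lts by (intro mult_le_less_imp_less) auto
      next
        case False
        then show ?thesis using that lts by (intro mult_less_le_imp_less) auto
      qed
      then show False using eq by simp
    qed
    moreover have False if "k \<le> i" "j \<le> l"
    proof -
      have "(x - of_int i) * (of_int j - x) < (x - of_int k) * (of_int l - x)"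
      proof (cases "i = k")
        case True
        then show ?thesis using that neq lts by (intro mult_le_less_imp_less) auto
      next
        case False
        then show ?thesis using that lts by (intro mult_less_le_imp_less) auto
      qed
      then show False using eq by simp
    qed
    ultimately show ?thesis by blast
  qed
qed

lemma convex_above_parabola: "convex {z. (Re z)\<^sup>2 \<le> Im z}"
proof (rule convexI)
  fix x y :: complex and u v :: real
  assume xy: "x \<in> {z. (Re z)\<^sup>2 \<le> Im z}" "y \<in> {z. (Re z)\<^sup>2 \<le> Im z}"
    and uv: "0 \<le> u" "0 \<le> v" "u + v = 1"
  have "(u * Re x + v * Re y)\<^sup>2 = u * (Re x)\<^sup>2 + v * (Re y)\<^sup>2 - u * v * (Re x - Re y)\<^sup>2"
  proof -
    have v: "v = 1 - u" using uv by simp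
    show ?thesis unfolding v by (simp add: power2_eq_square algebra_simps)
  qed
  also have "\<dots> \<le> u * (Re x)\<^sup>2 + v * (Re y)\<^sup>2" using uv by simp
  also have "\<dots> \<le> u * Im x + v * Im y"
    using xy uv by (intro add_mono mult_left_mono) auto
  finally show "u *\<^sub>R x + v *\<^sub>R y \<in> {z. (Re z)\<^sup>2 \<le> Im z}" by simp
qed

text \<open>The drawing with straight chords lies in the convex region above the parabola, whose
  complement therefore belongs to the outer face. The vertices lie on the parabola and are limits of
  points below it.\<close>

lemma outerplanarI_noncrossing:
  fixes f :: "'a \<Rightarrow> int"
  assumes G: "pair_graph G" and inj: "inj_on f (pverts G)"
    and nc: "\<And>u v x y. \<lbrakk>(u, v) \<in> parcs G; (x, y) \<in> parcs G; f u < f x; f x < f v; f v < f y\<rbrakk> \<Longrightarrow> False"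
  shows "outerplanar G"
proof -
  interpret G: pair_graph G by fact
  define p where "p = parabola \<circ> f"
  \<comment> \<open>Edges are drawn as a function of the vertex set, and the hull of two points is
    the segment between them.\<close>
  define c where "c S = convex hull (p ` S)" for S
  have c: "c {u, v} = closed_segment (p u) (p v)" for u v
    by (simp add: c_def segment_convex_hull)
  have arcV: "u \<in> pverts G" "v \<in> pverts G" if "(u, v) \<in> parcs G" for u v
    using that G.wellformed' by auto
  have arc_sym: "(v, u) \<in> parcs G" if "(u, v) \<in> parcs G" for u v
    using that G.graph_symmetric by auto
  have arc_neq: "f u \<noteq> f v" if "(u, v) \<in> parcs G" for u v
    using inj_onD[OF inj] arcV[OF that] G.no_loops' that by metis
  have inter: "c {u, v} \<inter> c {x, y} \<subseteq> p ` pverts G"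
    if uv: "(u, v) \<in> parcs G" "f u < f v" and xy: "(x, y) \<in> parcs G" "f x < f y" and neq: "{u, v} \<noteq> {x, y}"
    for u v x y
  proof
    fix z assume z: "z \<in> c {u, v} \<inter> c {x, y}"
    have "(f u, f v) \<noteq> (f x, f y)"
    proof
      assume "(f u, f v) = (f x, f y)"
      then have "u = x" "v = y" using inj_onD[OF inj] arcV uv xy by auto
      then show False using neq by simp
    qed
    then have "z = p u \<or> z = p v"
      using parabola_chords_inter[of z "f u" "f v" "f x" "f y"] z uv xy
        nc[OF uv(1) xy(1)] nc[OF xy(1) uv(1)] by (auto simp: c p_def)
    then show "z \<in> p ` pverts G" using arcV[OF uv(1)] by auto
  qed
  have ordered: "\<exists>a b. (a, b) \<in> parcs G \<and> f a < f b \<and> {u, v} = {a, b}" if "(u, v) \<in> parcs G" for u v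
    using that arc_sym[OF that] arc_neq[OF that] by (metis insert_commute linorder_neqE)
  have emb: "plane_embedding G p c"
    unfolding plane_embedding_def
  proof (intro conjI)
    show "inj_on p (pverts G)"
      using inj by (auto simp: inj_on_def p_def parabola_eq_iff)
    show "\<forall>(u,v) \<in> parcs G.
       (\<exists>g. arc g \<and> path_image g = c {u,v} \<and> pathstart g = p u \<and> pathfinish g = p v) \<and>
       c {u,v} \<inter> p ` pverts G = {p u, p v}"
    proof (clarify, intro conjI)
      fix u v assume uv: "(u, v) \<in> parcs G"
      have "p u \<noteq> p v" using arc_neq[OF uv] by (simp add: p_def parabola_eq_iff)
      then show "\<exists>g. arc g \<and> path_image g = c {u,v} \<and> pathstart g = p u \<and> pathfinish g = p v"
        by (intro exI[of _ "linepath (p u) (p v)"]) (simp add: c)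
      have "p w = p u \<or> p w = p v" if "p w \<in> c {u, v}" for w
      proof (cases "f u < f v")
        case True
        then show ?thesis
          using parabola_chord_vertex[of "f w" "f u" "f v"] that by (auto simp: c p_def)
      next
        case False
        then have "f v < f u" using arc_neq[OF uv] by simp
        then show ?thesis
          using parabola_chord_vertex[of "f w" "f v" "f u"] that
          by (auto simp: c p_def closed_segment_commute)
      qed
      then show "c {u,v} \<inter> p ` pverts G = {p u, p v}" using arcV[OF uv] by (auto simp: c)
    qed
    show "\<forall>(u,v) \<in> parcs G. \<forall>(x,y) \<in> parcs G.
       {u,v} \<noteq> {x,y} \<longrightarrow> c {u,v} \<inter> c {x,y} \<subseteq> p ` pverts G"
    proof (intro ballI, clarify)
      fix u v x y z
      assume uv: "(u, v) \<in> parcs G" and xy: "(x, y) \<in> parcs G" and "{u, v} \<noteq> {x, y}"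
        and z: "z \<in> c {u, v}" "z \<in> c {x, y}"
      moreover obtain a b where "(a, b) \<in> parcs G" "f a < f b" "{u, v} = {a, b}"
        using ordered[OF uv] by blast
      moreover obtain d e where "(d, e) \<in> parcs G" "f d < f e" "{x, y} = {d, e}"
        using ordered[OF xy] by blast
      ultimately show "z \<in> p ` pverts G" using inter[of a b d e] by auto
    qed
  qed
  let ?A = "{z :: complex. (Re z)\<^sup>2 \<le> Im z}"
  have pA: "p u \<in> ?A" for u by (simp add: p_def parabola_def)
  have cA: "c {u, v} \<subseteq> ?A" for u v
    unfolding c by (intro closed_segment_subset pA convex_above_parabola)
  have draw: "drawing G p c \<subseteq> ?A"
    using pA cA unfolding drawing_def by (intro Un_least image_subsetI UN_least) auto
  \<comment> \<open>Every point off a convex set lies in an unbounded component of its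
    complement.\<close>
  have out: "- ?A \<subseteq> outside (drawing G p c)"
    using outside_mono[OF draw] outside_convex[OF convex_above_parabola] by blast
  have "p u \<in> frontier (outside (drawing G p c))" if u: "u \<in> pverts G" for u
  proof -
    have "p u \<in> closure (- ?A)"
      unfolding closure_approachable
    proof (intro allI impI)
      fix e :: real assume "0 < e"
      then show "\<exists>y\<in>- ?A. dist y (p u) < e"
        by (intro bexI[of _ "p u - Complex 0 (e / 2)"])
          (auto simp: dist_norm p_def parabola_def complex_norm)
    qed
    then have "p u \<in> closure (outside (drawing G p c))" using closure_mono[OF out] by blast
    moreover have "p u \<notin> outside (drawing G p c)"
      using u by (auto simp: drawing_def outside_def)
    ultimately show ?thesis using interior_subset by (auto simp: frontier_def)
  qed
  then show ?thesis using emb unfolding outerplanar_def by blast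
qed

section \<open>From the hypotheses on digraphs to walks and adjacency\<close>

text \<open>Connectedness is strong connectedness of the symmetric closure; since \<open>G\<close>
  is symmetric, the closure adds no arcs, and reachability inside \<open>S\<close> remains.\<close>

lemma connected_induce_iff:
  assumes "pair_graph G"
  shows "Digraph_Component.connected (with_proj G \<restriction> S) \<longleftrightarrow>
    S \<noteq> {} \<and> (\<forall>u\<in>S. \<forall>v\<in>S. (\<lambda>x y. (x, y) \<in> parcs G \<and> x \<in> S \<and> y \<in> S)\<^sup>*\<^sup>* u v)"
    (is "_ \<longleftrightarrow> _ \<and> (\<forall>u\<in>S. \<forall>v\<in>S. ?r\<^sup>*\<^sup>* u v)")
proof -
  interpret G: pair_graph G by fact
  let ?M = "with_proj (mk_symmetric (with_proj G \<restriction> S))"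
  have V: "verts ?M = S" by (simp add: mk_symmetric_def)
  have A: "arcs_ends ?M = {(x, y). ?r x y}"
    using G.graph_symmetric by (auto simp: mk_symmetric_def arcs_ends_conv)
  have "(u, v) \<in> rtrancl_on S {(x, y). ?r x y} \<longleftrightarrow> ?r\<^sup>*\<^sup>* u v" if "u \<in> S" for u v
  proof
    assume "(u, v) \<in> rtrancl_on S {(x, y). ?r x y}"
    then show "?r\<^sup>*\<^sup>* u v"
    proof (induction rule: rtrancl_on_induct)
      case (step y z)
      then show ?case by (auto intro: rtranclp.rtrancl_into_rtrancl)
    qed simp
  next
    assume "?r\<^sup>*\<^sup>* u v"
    then show "(u, v) \<in> rtrancl_on S {(x, y). ?r x y}"
    proof (induction rule: rtranclp_induct)
      case (step y z)
      then show ?case by (auto intro: rtrancl_on_into_rtrancl_on)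
    qed (use that in simp)
  qed
  then show ?thesis
    unfolding Digraph_Component.connected_def strongly_connected_def reachable_def V A by auto
qed

text \<open>Every vertex of the walk is reachable from its head, and symmetry reverses one of two
  such walks.\<close>

lemma connected_induce_walk:
  assumes G: "pair_graph G" and xs: "xs \<noteq> []" "successively (\<lambda>x y. (x, y) \<in> parcs G) xs"
  shows "Digraph_Component.connected (with_proj G \<restriction> set xs)"
proof -
  interpret G: pair_graph G by fact
  let ?r = "\<lambda>x y. (x, y) \<in> parcs G \<and> x \<in> set xs \<and> y \<in> set xs"
  have "successively ?r xs" using xs(2) by (auto simp: successively_conv_nth)
  then have hd: "?r\<^sup>*\<^sup>* (hd xs) u" if "u \<in> set xs" for u
    using that by (rule successively_rtranclp_hd)
  have "symp ?r\<^sup>*\<^sup>*"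
    by (intro symp_rtranclp sympI) (use G.graph_symmetric in auto)
  then have "?r\<^sup>*\<^sup>* u v" if "u \<in> set xs" "v \<in> set xs" for u v
    using hd[OF that(1)] hd[OF that(2)] by (meson sympD rtranclp_trans)
  then show ?thesis unfolding connected_induce_iff[OF G] using xs(1) by simp
qed

lemma pair_graph_complete_bipartite: "pair_graph (complete_bipartite_graph m n)"
proof
  show "finite (parcs (complete_bipartite_graph m n))"
    by (rule finite_subset[of _ "{..<m + n} \<times> {..<m + n}"])
      (auto simp: complete_bipartite_graph_def symcl_def)
qed (auto simp: complete_bipartite_graph_def symcl_def symmetric_def sym_def)

lemma induced_free_claw:
  assumes G: "pair_graph G"
    and free: "induced_free (with_proj (complete_bipartite_graph 1 3)) (with_proj G)"
    and a: "(a, x) \<in> parcs G" "(a, y) \<in> parcs G" "(a, z) \<in> parcs G"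
    and d: "x \<noteq> y" "y \<noteq> z" "x \<noteq> z"
  shows "(x, y) \<in> parcs G \<or> (y, z) \<in> parcs G \<or> (x, z) \<in> parcs G"
proof (rule ccontr)
  assume no: "\<not> ?thesis"
  interpret G: pair_graph G by fact
  let ?K = "complete_bipartite_graph 1 3"
  let ?S = "{a, x, y, z}"
  let ?H = "\<lparr>pverts = ?S, parcs = {(u, v) \<in> parcs G. u \<in> ?S \<and> v \<in> ?S}\<rparr>"
  have sym: "(u, v) \<in> parcs G \<Longrightarrow> (v, u) \<in> parcs G" for u v
    using G.graph_symmetric by auto
  have irr: "(u, u) \<notin> parcs G" for u using G.no_loops' by blast
  have S: "?S \<subseteq> pverts G" using a G.wellformed' by auto
  have na: "a \<noteq> x" "a \<noteq> y" "a \<noteq> z" using a irr by auto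
  have H: "pair_graph ?H"
  proof
    show "finite (parcs ?H)" by (rule finite_subset[of _ "?S \<times> ?S"]) auto
    show "symmetric (with_proj ?H)" by (auto simp: symmetric_def sym_def intro: sym)
  qed (use irr in auto)
  interpret H: pair_graph ?H by (rule H)
  have "induced_subgraph (with_proj ?H) (with_proj G)"
    using S G.wf_digraph_axioms H.wf_digraph_axioms
    by (auto simp: induced_subgraph_def subgraph_def compatible_def)
  moreover have "digraph_iso (with_proj ?H) (with_proj ?K)"
  proof (rule digraph_iso_pairI_linorder[OF H pair_graph_complete_bipartite])
    let ?g = "\<lambda>k::nat. [a, x, y, z] ! k"
    have V: "pverts ?K = {0, 1, 2, 3}" by (auto simp: complete_bipartite_graph_def)
    show "bij_betw ?g (pverts ?K) (pverts ?H)"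
      unfolding V using na d by (auto simp: bij_betw_def)
    fix k l assume kl: "k \<in> pverts ?K" "l \<in> pverts ?K" "k < l"
    \<comment> \<open>The vertex 0 of \<open>?K\<close> is the centre of the claw and is sent to
      \<open>a\<close>.\<close>
    have "(k, l) \<in> parcs ?K \<longleftrightarrow> k = 0"
      using kl by (auto simp: complete_bipartite_graph_def symcl_def)
    moreover have "(?g k, ?g l) \<in> parcs ?H \<longleftrightarrow> k = 0"
      using kl a no unfolding V by auto
    ultimately show "(k, l) \<in> parcs ?K \<longleftrightarrow> (?g k, ?g l) \<in> parcs ?H" by blast
  qed
  ultimately show False using free unfolding induced_free_def by blast
qed

lemma minor_free_K4_walks:
  assumes G: "pair_graph G" and free: "minor_free (with_proj (complete_graph 4)) (with_proj G)"
    and ne: "A \<noteq> []" "B \<noteq> []" "C \<noteq> []" "D \<noteq> []"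
    and suc: "successively (\<lambda>u v. (u, v) \<in> parcs G) A" "successively (\<lambda>u v. (u, v) \<in> parcs G) B"
      "successively (\<lambda>u v. (u, v) \<in> parcs G) C" "successively (\<lambda>u v. (u, v) \<in> parcs G) D"
    and dist: "distinct (A @ B @ C @ D)"
    and adj: "\<exists>a\<in>set A. \<exists>b\<in>set B. (a, b) \<in> parcs G" "\<exists>a\<in>set A. \<exists>b\<in>set C. (a, b) \<in> parcs G"
      "\<exists>a\<in>set A. \<exists>b\<in>set D. (a, b) \<in> parcs G" "\<exists>a\<in>set B. \<exists>b\<in>set C. (a, b) \<in> parcs G"
      "\<exists>a\<in>set B. \<exists>b\<in>set D. (a, b) \<in> parcs G" "\<exists>a\<in>set C. \<exists>b\<in>set D. (a, b) \<in> parcs G"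
  shows False
proof -
  interpret G: pair_graph G by fact
  have sym: "(u, v) \<in> parcs G \<Longrightarrow> (v, u) \<in> parcs G" for u v
    using G.graph_symmetric by auto
  let ?K = "complete_graph 4"
  let ?B = "\<lambda>i::nat. set ([A, B, C, D] ! i)"
  have V: "verts (with_proj ?K) = {0, 1, 2, 3}" by (auto simp: complete_graph_def)
  have adj_lt: "\<exists>u\<in>?B x. \<exists>v\<in>?B y. (u, v) \<in> parcs G" if "x < y" "y < 4" for x y
  proof -
    from that consider "x = 0" "y = 1" | "x = 0" "y = 2" | "x = 0" "y = 3" | "x = 1" "y = 2"
      | "x = 1" "y = 3" | "x = 2" "y = 3" by linarith
    then show ?thesis by cases (use adj in simp_all)
  qed
  have "minor (with_proj ?K) (with_proj G)"
    unfolding minor_def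
  proof (intro exI[of _ ?B] conjI ballI impI)
    fix x assume x: "x \<in> verts (with_proj ?K)"
    have walk: "[A, B, C, D] ! x \<noteq> [] \<and> successively (\<lambda>u v. (u, v) \<in> parcs G) ([A, B, C, D] ! x)"
      using x ne suc unfolding V by auto
    then show conn: "Digraph_Component.connected (with_proj G \<restriction> ?B x)"
      using connected_induce_walk[OF G] by blast
    \<comment> \<open>A walk with a single vertex has no arc of its own, so membership in
      \<open>G\<close> starts from an arc to another branch set and spreads by
      connectedness.\<close>
    show "?B x \<subseteq> verts (with_proj G)"
    proof
      fix u assume u: "u \<in> ?B x"
      have "x = 0 \<or> x = 1 \<or> x = 2 \<or> x = 3" using x unfolding V by blast
      then obtain w where w: "w \<in> ?B x" "w \<in> pverts G"
        using adj G.wellformed' by fastforce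
      have "(\<lambda>p q. (p, q) \<in> parcs G \<and> p \<in> ?B x \<and> q \<in> ?B x)\<^sup>*\<^sup>* w u"
        using conn u w(1) unfolding connected_induce_iff[OF G] by blast
      then show "u \<in> verts (with_proj G)"
        using w(2) G.wellformed' by cases auto
    qed
    fix y assume y: "y \<in> verts (with_proj ?K)" "x \<noteq> y"
    show "?B x \<inter> ?B y = {}" using x y dist unfolding V by auto
  next
    fix e assume "e \<in> arcs_ends (with_proj ?K)"
    then obtain x y where e: "e = (x, y)" "x < 4" "y < 4" "x \<noteq> y"
      by (auto simp: complete_graph_def arcs_ends_conv)
    consider "x < y" | "y < x" using e by linarith
    then have "\<exists>u\<in>?B x. \<exists>v\<in>?B y. (u, v) \<in> parcs G"
      by cases (use adj_lt[of x y] adj_lt[of y x] e sym in blast)+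
    then show "case e of (x, y) \<Rightarrow> \<exists>u\<in>?B x. \<exists>v\<in>?B y. u \<rightarrow>\<^bsub>with_proj G\<^esub> v"
      by (auto simp: e arcs_ends_conv)
  qed
  then show False using free by (simp add: minor_free_def)
qed

lemma claw_K4_free_graph_of_pair_graph:
  assumes G: "pair_graph G"
    and conn: "k_connected 2 (with_proj G)"
    and claw: "induced_free (with_proj (complete_bipartite_graph 1 3)) (with_proj G)"
    and K4: "minor_free (with_proj (complete_graph 4)) (with_proj G)"
  shows "claw_K4_free_graph (pverts G) (\<lambda>u v. (u, v) \<in> parcs G)"
proof
  interpret G: pair_graph G by fact
  show "finite (pverts G)" using G.finite_verts by simp
  show "u \<in> pverts G" if "(u, v) \<in> parcs G" for u v using that G.wellformed' by auto
  show "(v, u) \<in> parcs G" if "(u, v) \<in> parcs G" for u v using that G.graph_symmetric by auto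
  show "(u, u) \<notin> parcs G" for u using G.no_loops' by blast
  show "3 \<le> card (pverts G)" using conn by (simp add: k_connected_def)
  show "(x, y) \<in> parcs G \<or> (y, z) \<in> parcs G \<or> (x, z) \<in> parcs G"
    if "(a, x) \<in> parcs G" "(a, y) \<in> parcs G" "(a, z) \<in> parcs G" "x \<noteq> y" "y \<noteq> z" "x \<noteq> z" for a x y z
    by (rule induced_free_claw[OF G claw that])
  show False
    if "A \<noteq> []" "B \<noteq> []" "C \<noteq> []" "D \<noteq> []"
      "successively (\<lambda>u v. (u, v) \<in> parcs G) A" "successively (\<lambda>u v. (u, v) \<in> parcs G) B"
      "successively (\<lambda>u v. (u, v) \<in> parcs G) C" "successively (\<lambda>u v. (u, v) \<in> parcs G) D"
      "distinct (A @ B @ C @ D)"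
      "\<exists>a\<in>set A. \<exists>b\<in>set B. (a, b) \<in> parcs G" "\<exists>a\<in>set A. \<exists>b\<in>set C. (a, b) \<in> parcs G"
      "\<exists>a\<in>set A. \<exists>b\<in>set D. (a, b) \<in> parcs G" "\<exists>a\<in>set B. \<exists>b\<in>set C. (a, b) \<in> parcs G"
      "\<exists>a\<in>set B. \<exists>b\<in>set D. (a, b) \<in> parcs G" "\<exists>a\<in>set C. \<exists>b\<in>set D. (a, b) \<in> parcs G"
    for A B C D
    by (rule minor_free_K4_walks[OF G K4 that])
  fix v x y assume v: "v \<in> pverts G" and xy: "x \<in> pverts G - {v}" "y \<in> pverts G - {v}"
  let ?S = "pverts G - {v}"
  let ?r = "\<lambda>x y. (x, y) \<in> parcs G \<and> x \<in> ?S \<and> y \<in> ?S"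
  have "Digraph_Component.connected (with_proj G \<restriction> (verts (with_proj G) - {v}))"
    using conn v unfolding k_connected_def by auto
  then have "?r\<^sup>*\<^sup>* x y"
    using xy unfolding connected_induce_iff[OF G] by auto
  then obtain xs where xs: "xs \<noteq> []" "hd xs = x" "last xs = y" "successively ?r xs" "distinct xs"
    using rtranclp_imp_distinct_walk[of ?r x y] by blast
  have "v \<notin> set xs"
  proof
    assume "v \<in> set xs"
    then have "?r\<^sup>*\<^sup>* x v" using successively_rtranclp_hd[OF xs(4)] xs(2) by simp
    then show False using xy(1) by (auto elim: rtranclp.cases)
  qed
  moreover have "successively (\<lambda>u v. (u, v) \<in> parcs G) xs"
    using xs(4) by (rule successively_mono) auto
  ultimately show "\<exists>xs. xs \<noteq> [] \<and> hd xs = x \<and> last xs = y \<and>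
      successively (\<lambda>u v. (u, v) \<in> parcs G) xs \<and> distinct xs \<and> v \<notin> set xs"
    using xs by blast
qed

theorem theorem4p1:
  fixes G :: "'a pair_pre_digraph"
  assumes "pair_graph G"
    and "k_connected 2 (with_proj G)"
    and "induced_free (with_proj (complete_bipartite_graph 1 3)) (with_proj G)"
    and "minor_free (with_proj (complete_graph 4)) (with_proj G)"
  shows "outerplanar G \<and>
    ((\<exists>d\<ge>1. digraph_iso (with_proj G) (with_proj (graph_Z d)) \<or>
            digraph_iso (with_proj G) (graph_Zstar d)) \<or>
     (\<exists>t\<ge>3. \<exists>H \<in> graphs_S t. digraph_iso (with_proj G) (with_proj H)))"
proof -
  interpret claw_K4_free_graph "pverts G" "\<lambda>u v. (u, v) \<in> parcs G"
    using assms by (rule claw_K4_free_graph_of_pair_graph)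
  obtain c n where c: "outerplanar_labelling (\<lambda>u v. (u, v) \<in> parcs G) c n" "range c = pverts G"
    using outerplanar_labelling_exists by blast
  interpret L: outerplanar_labelling "\<lambda>u v. (u, v) \<in> parcs G" c n by (rule c(1))
  have bij: "bij_betw c {0..<n} (pverts G)"
    using L.bij_betw_window[of 0] c(2) by simp
  \<comment> \<open>The label of each vertex within one period; as all labels differ by less than
    \<open>n\<close>, \<open>noncrossing\<close> applies to them.\<close>
  let ?f = "inv_into {0..<n} c"
  have f: "c (?f u) = u" "?f u \<in> {0..<n}" if "u \<in> pverts G" for u
    using that bij_betw_inv_into_right[OF bij] bij_betwE[OF bij_betw_inv_into[OF bij]] by auto
  have "outerplanar G"
  proof (rule outerplanarI_noncrossing[OF assms(1)])
    show "inj_on ?f (pverts G)" using bij_betw_inv_into[OF bij] by (simp add: bij_betw_def)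
    fix u v x y
    assume "(u, v) \<in> parcs G" "(x, y) \<in> parcs G" "?f u < ?f x" "?f x < ?f v" "?f v < ?f y"
    moreover from this have V: "u \<in> pverts G" "v \<in> pverts G" "x \<in> pverts G" "y \<in> pverts G"
      using E_V E_V2 by blast+
    moreover have "?f y < ?f u + n" using f(2)[OF V(1)] f(2)[OF V(4)] by auto
    ultimately show False
      using L.noncrossing[of "?f u" "?f x" "?f v" "?f y"] f(1) by simp
  qed
  moreover have "(\<exists>d\<ge>1. digraph_iso (with_proj G) (with_proj (graph_Z d)) \<or>
            digraph_iso (with_proj G) (graph_Zstar d)) \<or>
     (\<exists>t\<ge>3. \<exists>H \<in> graphs_S t. digraph_iso (with_proj G) (with_proj H))"
    using assms(1) c(2) by (intro L.zigzag_or_sun) auto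
  ultimately show ?thesis ..
qed

end
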